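(* Let $E$ be a real normed vector space, $\Omega\subset E$ a nonempty convex open set, and let $(f_n)_{n\in\mathbb{N}}$ be a sequence of real-valued Lipschitz convex functions on $\Omega$ satisfying property $(H)$ at $\hat{x}\in \Omega$, with $f_\infty$ the function given by property $(H)$. Assume that there exists $w\in E$ such that $$\sup_{n\geq 1} d^+ f_n(\hat{x})(w) < 0.$$ Then the following assertions are equivalent. (a) $\hat{x}$ is a solution of the problem $$(\mathcal{P}_\infty)\qquad \min f_0(x)\quad\text{subject to } x\in\Omega,\ f_n(x)\le 0\ \ \forall n\geq 1 .$$ (b) There exists a sequence of real numbers $(\beta_{\infty},\beta_0,\beta_1,\ldots)$ such that: (i) $\beta_{\infty}\geq 0$, $\beta_n\geq 0$ for all $n\in \mathbb{N}$, (ii) $\beta_{\infty} f_{\infty}(\hat{x})=0$ and $\beta_{n} f_n(\hat{x})= 0$ for all $n\geq 1$, (iii) $d^+ f_0(\hat{x}) (u)+\beta_\infty d^+f_{\infty}(\hat{x})(u)+\sum_{n\geq 1} \beta_{n} d^+f_n(\hat{x})(u)\geq 0$ for all $u\in E$. (c) There exists a sequence of real numbers $(\beta_{\infty},\beta_0,\beta_1,\ldots)$ such that: (i) $\beta_{\infty}\geq 0$, $\beta_n\geq 0$ for all $n\in \mathbb{N}$, (ii) $\beta_{\infty} f_{\infty}(\hat{x})=0$ and $\beta_{n} f_n(\hat{x})= 0$ for all $n\geq 1$, (iii) the function $f_0+\beta_\infty f_{\infty}+\sum_{n\geq 1} \beta_{n} f_n$ has a global minimum on $\Omega$ at $\ha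t{x}$.
   Context: $\mathbb{N}=\{0,1,2,\ldots\}$. A solution of $(\mathcal{P}_\infty)$ is a point $x\in\Omega$ with $f_n(x)\le 0$ for all $n\ge 1$ at which $f_0$ attains its minimum over all such points. For a function $f$ convex on a convex neighborhood of $x$, $d^+ f(x)(u):=\lim_{t\to 0^+} \frac{f(x+tu)-f(x)}{t}$ is the right-hand directional derivative; it coincides with the upper Dini derivative $D^+ f(x)(u) :=\limsup_{t\to 0^+} \frac{f(x+tu)-f(x)}{t}$. A function $p:E\to\mathbb{R}$ is sublinear if $p(x+y)\le p(x)+p(y)$ and $p(\lambda x)=\lambda p(x)$ for all $x,y\in E$ and real $\lambda\ge 0$. Let $B(\hat{x},r)$ be the open ball of center $\hat{x}$ and radius $r\in(0,+\infty]$ (with $B(\hat x,+\infty)=E$). For a real-valued Lipschitz function $h$ on $B(\hat{x},r)\cap\Omega$ put $\|h\|_{\hat{x},r}=\sup_{x\ne y\in B(\hat{x},r)\cap\Omega}\frac{|h(x)-h(y)|}{\|x-y\|}$. Property $(H)$ at $\hat{x}$: there is $r\in(0,+\infty]$ such that every $f_n$ is Lipschitz on $B(\hat{x},r)\cap\Omega$, and: (i) $D^+f_n(\hat{x})$ is sublinear for all $n\in\mathbb{N}$; (ii) there exists a function $f_\infty:\Omega\to\mathbb{R}$, Lipschitz on $B(\hat{x},r)\cap\Omega$, such that $f_\infty(\hat{x})=\lim_{n\to\infty}f_n(\hat{x})$ and $\|f_n-f_\infty\|_{\hat{x},r}\to 0$ as $n\to\infty$.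
   Formalization: (a)⇔(b) is stated for feasible x̂ (f_n(x̂)≤0 for n≥1), and (b)⇒(c) for f_∞ convex on all of Ω, since both fail otherwise; in (c) the series is summed in the extended reals, as it may be +∞ far from x̂. *)

theory Defs
  imports "HOL-Analysis.Analysis"
begin

text \<open>Right-hand directional derivative, for functions convex near \<open>x\<close> (so that the limit exists).\<close>

definition dplus :: "('a::real_normed_vector \<Rightarrow> real) \<Rightarrow> 'a \<Rightarrow> 'a \<Rightarrow> real" where
  "dplus f x u = Lim (at_right 0) (\<lambda>t. (f (x + t *\<^sub>R u) - f x) / t)"

definition upper_dini :: "('a::real_normed_vector \<Rightarrow> real) \<Rightarrow> 'a \<Rightarrow> 'a \<Rightarrow> ereal" where
  "upper_dini f x u = Limsup (at_right 0) (\<lambda>t. ereal ((f (x + t *\<^sub>R u) - f x) / t))"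

definition sublinear :: "('a::real_vector \<Rightarrow> real) \<Rightarrow> bool" where
  "sublinear p \<longleftrightarrow>
     (\<forall>x y. p (x + y) \<le> p x + p y) \<and> (\<forall>x c. 0 \<le> c \<longrightarrow> p (c *\<^sub>R x) = c * p x)"

text \<open>The radius may be infinite, in which case the ball is the whole space.\<close>

definition eball :: "'a::real_normed_vector \<Rightarrow> ereal \<Rightarrow> 'a set" where
  "eball x r = {y. ereal (dist x y) < r}"

text \<open>In \<open>ennreal\<close> the supremum is meaningful without any boundedness or nonemptiness condition
  on the set of difference quotients.\<close>

definition lip_seminorm :: "'a::real_normed_vector set \<Rightarrow> ('a \<Rightarrow> real) \<Rightarrow> ennreal" where
  "lip_seminorm S h =
     (SUP (x, y)\<in>{(x, y). x \<in> S \<and> y \<in> S \<and> x \<noteq> y}. ennreal (\<bar>h x - h y\<bar> / norm (x - y)))"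

text \<open>Functions on \<open>\<Omega>\<close> are total functions whose values outside \<open>\<Omega>\<close> are irrelevant.
  The limit function is a parameter: \<open>property_H \<Omega> f z finf\<close> says that property (H) holds at \<open>z\<close>
  with \<open>finf\<close> as a witness for \<open>f\<^sub>\<infinity>\<close>.\<close>

definition property_H ::
  "'a::real_normed_vector set \<Rightarrow> (nat \<Rightarrow> 'a \<Rightarrow> real) \<Rightarrow> 'a \<Rightarrow> ('a \<Rightarrow> real) \<Rightarrow> bool" where
  "property_H \<Omega> f z finf \<longleftrightarrow>
     (\<exists>r::ereal. 0 < r \<and>
        (\<forall>n. \<exists>L. L-lipschitz_on (eball z r \<inter> \<Omega>) (f n)) \<and>
        (\<forall>n. \<exists>p. sublinear p \<and> (\<forall>u. upper_dini (f n) z u = ereal (p u))) \<and>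
        (\<exists>L. L-lipschitz_on (eball z r \<inter> \<Omega>) finf) \<and>
        (\<lambda>n. f n z) \<longlonglongrightarrow> finf z \<and>
        (\<lambda>n. lip_seminorm (eball z r \<inter> \<Omega>) (\<lambda>x. f n x - finf x)) \<longlonglongrightarrow> 0)"

definition feasible :: "'a set \<Rightarrow> (nat \<Rightarrow> 'a \<Rightarrow> real) \<Rightarrow> 'a \<Rightarrow> bool" where
  "feasible \<Omega> f x \<longleftrightarrow> x \<in> \<Omega> \<and> (\<forall>n\<ge>1. f n x \<le> 0)"

definition is_solution :: "'a set \<Rightarrow> (nat \<Rightarrow> 'a \<Rightarrow> real) \<Rightarrow> 'a \<Rightarrow> bool" where
  "is_solution \<Omega> f z \<longleftrightarrow> feasible \<Omega> f z \<and> (\<forall>x. feasible \<Omega> f x \<longrightarrow> f 0 z \<le> f 0 x)"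

definition multipliers ::
  "(nat \<Rightarrow> 'a \<Rightarrow> real) \<Rightarrow> ('a \<Rightarrow> real) \<Rightarrow> 'a \<Rightarrow> real \<Rightarrow> (nat \<Rightarrow> real) \<Rightarrow> bool" where
  "multipliers f finf z binf b \<longleftrightarrow>
     0 \<le> binf \<and> (\<forall>n. 0 \<le> b n) \<and>
     binf * finf z = 0 \<and> (\<forall>n\<ge>1. b n * f n z = 0)"

text \<open>Series over \<open>n \<ge> 1\<close> are written with \<open>Suc n\<close>; since \<^term>\<open>suminf\<close> is unspecified for
  divergent series, convergence is stated explicitly.\<close>

definition derivative_condition ::
  "(nat \<Rightarrow> 'a::real_normed_vector \<Rightarrow> real) \<Rightarrow> ('a \<Rightarrow> real) \<Rightarrow> 'a \<Rightarrow> real \<Rightarrow> (nat \<Rightarrow> real) \<Rightarrow> bool" where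
  "derivative_condition f finf z binf b \<longleftrightarrow>
     (\<forall>u. summable (\<lambda>n. b (Suc n) * dplus (f (Suc n)) z u) \<and>
          0 \<le> dplus (f 0) z u + binf * dplus finf z u
               + (\<Sum>n. b (Suc n) * dplus (f (Suc n)) z u))"

text \<open>The sum of the series of functions is taken in the extended reals: far from \<open>z\<close> the
  functions \<open>f n\<close> are not uniformly bounded, and the series may diverge to \<open>+\<infinity>\<close>.
  For multipliers the series vanishes at \<open>z\<close>, so the minimum value is real and the value
  \<open>-\<infinity>\<close> is excluded on \<open>\<Omega>\<close>.\<close>

definition lagrangian ::
  "(nat \<Rightarrow> 'a \<Rightarrow> real) \<Rightarrow> ('a \<Rightarrow> real) \<Rightarrow> real \<Rightarrow> (nat \<Rightarrow> real) \<Rightarrow> 'a \<Rightarrow> ereal" where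
  "lagrangian f finf binf b x =
     ereal (f 0 x + binf * finf x) + (\<Sum>n. ereal (b (Suc n) * f (Suc n) x))"

definition minimum_condition ::
  "'a set \<Rightarrow> (nat \<Rightarrow> 'a \<Rightarrow> real) \<Rightarrow> ('a \<Rightarrow> real) \<Rightarrow> 'a \<Rightarrow> real \<Rightarrow> (nat \<Rightarrow> real) \<Rightarrow> bool" where
  "minimum_condition \<Omega> f finf z binf b \<longleftrightarrow>
     (\<forall>x\<in>\<Omega>. summable (\<lambda>n. ereal (b (Suc n) * f (Suc n) x)) \<and>
             lagrangian f finf binf b z \<le> lagrangian f finf binf b x)"

end

theory Submission
  imports Defs
begin

text \<open>At a solution \<open>z\<close> no direction decreases \<open>f 0\<close> and all active constraints, including the limit
  constraint, to first order; property (H) makes this uniform in \<open>n\<close>. Multipliers are then sought in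
  the set of measures of total mass at most \<open>M\<close> on the compact space \<open>\<nat> \<union> {\<infinity>}\<close>, which is compact for
  pointwise convergence together with convergence of the total mass, as mass can escape only to
  \<open>\<infinity>\<close>. Since the directional derivatives of \<open>f n\<close> converge to those of \<open>finf\<close>, the condition imposed
  by a single direction is closed, and Fan's minimax theorem satisfies all conditions at once; this
  replaces the Hahn-Banach theorem, and the Slater direction \<open>w\<close> supplies \<open>M\<close>. Conversely, at a
  minimum of the Lagrangian the direction \<open>w\<close> forces \<open>b\<close> to be summable, and dominated
  convergence differentiates the series term by term.\<close>

section \<open>Fan's alternative\<close>

text \<open>Separation in the plane: the points lying below the image of \<open>K\<close> under
  (\<phi>, \<psi>) form a convex set, since \<open>concave\<close> asks that some point of
  \<open>K\<close> dominate each convex combination of values; \<open>K\<close> itself carries no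
  linear structure. The normal of a line separating this set from a quadrant is nonnegative and,
  normalized, gives \<open>t\<close>.\<close>

lemma two_function_alternative:
  fixes \<phi> \<psi> :: "'b::topological_space \<Rightarrow> real"
  assumes K: "compact K" "K \<noteq> {}"
    and cont: "continuous_on K \<phi>" "continuous_on K \<psi>"
    and concave: "\<And>x y t. x \<in> K \<Longrightarrow> y \<in> K \<Longrightarrow> 0 \<le> t \<Longrightarrow> t \<le> 1 \<Longrightarrow>
      \<exists>c\<in>K. t * \<phi> x + (1 - t) * \<phi> y \<le> \<phi> c \<and> t * \<psi> x + (1 - t) * \<psi> y \<le> \<psi> c"
    and none: "\<And>x. x \<in> K \<Longrightarrow> \<phi> x < 0 \<or> \<psi> x < 0"
  obtains t where "0 \<le> t" "t \<le> 1" "\<And>x. x \<in> K \<Longrightarrow> t * \<phi> x + (1 - t) * \<psi> x < 0"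
proof -
  have "continuous_on K (\<lambda>x. min (\<phi> x) (\<psi> x))"
    using cont by (intro continuous_on_min)
  then obtain x0 where x0: "x0 \<in> K" "\<And>x. x \<in> K \<Longrightarrow> min (\<phi> x) (\<psi> x) \<le> min (\<phi> x0) (\<psi> x0)"
    using continuous_attains_sup[OF K] by blast
  \<comment> \<open>By compactness \<open>m\<close> is the largest value of the minimum, so
    \<open>none\<close> makes it strictly negative, and the open quadrant \<open>Q\<close> at (m, m)
    contains points with negative coordinates.\<close>
  define m where "m = min (\<phi> x0) (\<psi> x0)"
  have m: "m < 0" using none[OF x0(1)] by (auto simp: m_def)
  define D where "D = {p :: real \<times> real. \<exists>x\<in>K. fst p \<le> \<phi> x \<and> snd p \<le> \<psi> x}"
  define Q where "Q = {p :: real \<times> real. m < fst p \<and> m < snd p}"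
  have "convex D"
    unfolding convex_alt
  proof (intro ballI allI impI)
    fix p q :: "real \<times> real" and t :: real
    assume "p \<in> D" "q \<in> D" and t: "0 \<le> t \<and> t \<le> 1"
    then obtain x y where xy: "x \<in> K" "fst p \<le> \<phi> x" "snd p \<le> \<psi> x"
      "y \<in> K" "fst q \<le> \<phi> y" "snd q \<le> \<psi> y"
      unfolding D_def by blast
    obtain c where c: "c \<in> K" "t * \<phi> y + (1 - t) * \<phi> x \<le> \<phi> c" "t * \<psi> y + (1 - t) * \<psi> x \<le> \<psi> c"
      using concave[OF xy(4) xy(1), of t] t by blast
    have "t * fst q + (1 - t) * fst p \<le> t * \<phi> y + (1 - t) * \<phi> x"
      "t * snd q + (1 - t) * snd p \<le> t * \<psi> y + (1 - t) * \<psi> x"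
      using xy t by (auto intro!: add_mono mult_left_mono)
    with c have "(1 - t) * fst p + t * fst q \<le> \<phi> c" "(1 - t) * snd p + t * snd q \<le> \<psi> c"
      by linarith+
    with c(1) show "(1 - t) *\<^sub>R p + t *\<^sub>R q \<in> D"
      unfolding D_def by auto
  qed
  moreover have "convex Q"
  proof -
    have "Q = {m<..} \<times> {m<..}" unfolding Q_def by auto
    then show ?thesis by (simp add: convex_Times)
  qed
  moreover have "D \<noteq> {}" "Q \<noteq> {}"
  proof -
    have "(\<phi> x0, \<psi> x0) \<in> D" using x0(1) by (auto simp: D_def)
    then show "D \<noteq> {}" by blast
    have "(m + 1, m + 1) \<in> Q" by (simp add: Q_def)
    then show "Q \<noteq> {}" by blast
  qed
  moreover have "D \<inter> Q = {}"
    using x0(2) unfolding D_def Q_def m_def[symmetric]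
    by (force simp: min_def split: if_splits)
  ultimately obtain a b where ab: "a \<noteq> 0" "\<And>p. p \<in> D \<Longrightarrow> inner a p \<le> b" "\<And>p. p \<in> Q \<Longrightarrow> b \<le> inner a p"
    using separating_hyperplane_sets[of D Q] by metis
  obtain c d where a: "a = (c, d)" by (cases a)
  \<comment> \<open>\<open>Q\<close> is unbounded along both axes, so a functional bounded below on
    it cannot have a negative coefficient.\<close>
  have cd: "0 \<le> c" "0 \<le> d"
  proof -
    define k where "k = b - (c + d) * (m + 1)"
    have Q1: "b \<le> c * (m + 1 + s) + d * (m + 1 + r)" if "0 \<le> s" "0 \<le> r" for s r
      using ab(3)[of "(m + 1 + s, m + 1 + r)"] that by (simp add: Q_def a)
    have "k \<le> c * s" if "0 \<le> s" for s
      using Q1[of s 0] that by (simp add: k_def algebra_simps)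
    from this[of "(\<bar>k\<bar> + 1) / \<bar>c\<bar>"] show "0 \<le> c"
      by (cases "c < 0") (auto simp: divide_nonneg_neg)
    have "k \<le> d * s" if "0 \<le> s" for s
      using Q1[of 0 s] that by (simp add: k_def algebra_simps)
    from this[of "(\<bar>k\<bar> + 1) / \<bar>d\<bar>"] show "0 \<le> d"
      by (cases "d < 0") (auto simp: divide_nonneg_neg)
  qed
  have sum: "c + d > 0" using ab(1) cd a by (auto simp: zero_prod_def)
  \<comment> \<open>\<open>Q\<close> contains (m/2, m/2), where the functional is negative.\<close>
  have b: "b < 0"
  proof -
    have "b \<le> c * (m / 2) + d * (m / 2)"
      using ab(3)[of "(m / 2, m / 2)"] m by (simp add: Q_def a)
    also have "\<dots> = (c + d) * m / 2" by (simp add: algebra_simps)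
    also have "\<dots> < 0" using sum m by (simp add: mult_pos_neg)
    finally show ?thesis .
  qed
  show thesis
  proof
    show "0 \<le> c / (c + d)" "c / (c + d) \<le> 1" using cd sum by auto
    fix x assume "x \<in> K"
    then have "(\<phi> x, \<psi> x) \<in> D" by (auto simp: D_def)
    then have "c * \<phi> x + d * \<psi> x < 0" using ab(2)[of "(\<phi> x, \<psi> x)"] b a by simp
    moreover have "1 - c / (c + d) = d / (c + d)"
      using sum by (simp add: field_simps)
    then have "c / (c + d) * \<phi> x + (1 - c / (c + d)) * \<psi> x = (c * \<phi> x + d * \<psi> x) / (c + d)"
      by (simp add: add_divide_distrib)
    ultimately show "c / (c + d) * \<phi> x + (1 - c / (c + d)) * \<psi> x < 0"
      using sum by (simp add: divide_neg_pos)
  qed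
qed

text \<open>Produces a set closed in the whole space, as the intersection arguments for compact sets
  require; continuity on \<open>K\<close> yields closedness relative to \<open>K\<close>.\<close>

lemma continuous_on_nonneg_eq_Int_closed:
  fixes \<phi> :: "'b::topological_space \<Rightarrow> real"
  assumes "continuous_on K \<phi>"
  obtains T where "closed T" "{x \<in> K. 0 \<le> \<phi> x} = K \<inter> T"
proof -
  have "closedin (top_of_set K) (K \<inter> \<phi> -` {0..})"
    using assms by (intro continuous_closedin_preimage) auto
  then obtain T where "closed T" "K \<inter> \<phi> -` {0..} = K \<inter> T"
    by (auto simp: closedin_closed)
  moreover have "{x \<in> K. 0 \<le> \<phi> x} = K \<inter> \<phi> -` {0..}" by auto
  ultimately show thesis using that by simp
qed

text \<open>Restricting \<open>K\<close> to the set where one of the functions is nonnegative preserves all hypotheses, by the case of two functions.\<close>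

lemma fan_alternative_finite:
  fixes \<Phi> :: "'u \<Rightarrow> 'b::topological_space \<Rightarrow> real"
  assumes "finite U" "U \<subseteq> X"
    and "compact K" "K \<noteq> {}"
    and "\<And>u. u \<in> X \<Longrightarrow> continuous_on K (\<Phi> u)"
    and "\<And>x y t. x \<in> K \<Longrightarrow> y \<in> K \<Longrightarrow> 0 \<le> t \<Longrightarrow> t \<le> 1 \<Longrightarrow>
      \<exists>c\<in>K. \<forall>u\<in>X. t * \<Phi> u x + (1 - t) * \<Phi> u y \<le> \<Phi> u c"
    and "\<And>u v t. u \<in> X \<Longrightarrow> v \<in> X \<Longrightarrow> 0 \<le> t \<Longrightarrow> t \<le> 1 \<Longrightarrow>
      \<exists>c\<in>X. \<forall>x\<in>K. \<Phi> c x \<le> t * \<Phi> u x + (1 - t) * \<Phi> v x"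
    and "\<And>u. u \<in> X \<Longrightarrow> \<exists>x\<in>K. 0 \<le> \<Phi> u x"
  shows "\<exists>x\<in>K. \<forall>u\<in>U. 0 \<le> \<Phi> u x"
  using assms
proof (induction U arbitrary: K rule: finite_induct)
  case empty
  then show ?case by auto
next
  case (insert v U)
  note concave = insert.prems(5) and convex = insert.prems(6) and pos = insert.prems(7)
  have v: "v \<in> X" using insert.prems(1) by simp
  define K' where "K' = {x \<in> K. 0 \<le> \<Phi> v x}"
  have "\<exists>x\<in>K'. \<forall>u\<in>U. 0 \<le> \<Phi> u x"
  proof (rule insert.IH)
    show "U \<subseteq> X" using insert.prems(1) by simp
    obtain T where "closed T" "K' = K \<inter> T"
      using continuous_on_nonneg_eq_Int_closed[OF insert.prems(4)[OF v]] unfolding K'_def by metis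
    then show "compact K'" using insert.prems(2) by (simp add: compact_Int_closed)
    show "K' \<noteq> {}" using pos[OF v] by (auto simp: K'_def)
    show "continuous_on K' (\<Phi> u)" if "u \<in> X" for u
      using insert.prems(4)[OF that] by (rule continuous_on_subset) (auto simp: K'_def)
    show "\<exists>c\<in>X. \<forall>x\<in>K'. \<Phi> c x \<le> t * \<Phi> u x + (1 - t) * \<Phi> w x"
      if "u \<in> X" "w \<in> X" "0 \<le> t" "t \<le> 1" for u w t
      using convex[OF that] by (auto simp: K'_def)
    show "\<exists>c\<in>K'. \<forall>u\<in>X. t * \<Phi> u x + (1 - t) * \<Phi> u y \<le> \<Phi> u c"
      if "x \<in> K'" "y \<in> K'" "0 \<le> t" "t \<le> 1" for x y t
    proof -
      obtain c where c: "c \<in> K" "\<forall>u\<in>X. t * \<Phi> u x + (1 - t) * \<Phi> u y \<le> \<Phi> u c"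
        using concave[of x y t] \<open>x \<in> K'\<close> \<open>y \<in> K'\<close> \<open>0 \<le> t\<close> \<open>t \<le> 1\<close> unfolding K'_def by blast
      \<comment> \<open>The dominating point stays in \<open>K'\<close>, because its value under
        \<Phi> v is above a combination of nonnegative values.\<close>
      have "0 \<le> t * \<Phi> v x + (1 - t) * \<Phi> v y"
        using that by (auto simp: K'_def)
      with c v have "c \<in> K'" by (force simp: K'_def)
      with c(2) show ?thesis by blast
    qed
    show "\<exists>x\<in>K'. 0 \<le> \<Phi> u x" if u: "u \<in> X" for u
    proof (rule ccontr)
      \<comment> \<open>Then \<Phi> u and \<Phi> v are never both nonnegative on \<open>K\<close>,
        so some mixture of them is negative throughout; an element of \<open>X\<close> lying below
        this mixture contradicts \<open>pos\<close>.\<close>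
      assume neg: "\<not> (\<exists>x\<in>K'. 0 \<le> \<Phi> u x)"
      obtain t where t: "0 \<le> t" "t \<le> 1" "\<And>x. x \<in> K \<Longrightarrow> t * \<Phi> u x + (1 - t) * \<Phi> v x < 0"
      proof (rule two_function_alternative[of K "\<Phi> u" "\<Phi> v"])
        show "compact K" "K \<noteq> {}" "continuous_on K (\<Phi> u)" "continuous_on K (\<Phi> v)"
          using insert.prems u v by auto
        show "\<exists>c\<in>K. t * \<Phi> u x + (1 - t) * \<Phi> u y \<le> \<Phi> u c \<and> t * \<Phi> v x + (1 - t) * \<Phi> v y \<le> \<Phi> v c"
          if "x \<in> K" "y \<in> K" "0 \<le> t" "t \<le> 1" for x y t
          using concave[OF that] u v by blast
        show "\<Phi> u x < 0 \<or> \<Phi> v x < 0" if "x \<in> K" for x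
          using neg that by (auto simp: K'_def not_le)
      qed blast
      obtain c where c: "c \<in> X" "\<forall>x\<in>K. \<Phi> c x \<le> t * \<Phi> u x + (1 - t) * \<Phi> v x"
        using convex[OF u v t(1,2)] by blast
      with pos[OF c(1)] t(3) show False by force
    qed
  qed
  then show ?case by (auto simp: K'_def)
qed

text \<open>The sets where one function is nonnegative are closed in the compact \<open>K\<close>,
  so the finite intersection property extends the finite case to arbitrary \<open>X\<close>.\<close>

lemma fan_alternative:
  fixes \<Phi> :: "'u \<Rightarrow> 'b::topological_space \<Rightarrow> real"
  assumes K: "compact K" "K \<noteq> {}"
    and cont: "\<And>u. u \<in> X \<Longrightarrow> continuous_on K (\<Phi> u)"
    and "\<And>x y t. x \<in> K \<Longrightarrow> y \<in> K \<Longrightarrow> 0 \<le> t \<Longrightarrow> t \<le> 1 \<Longrightarrow>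
      \<exists>c\<in>K. \<forall>u\<in>X. t * \<Phi> u x + (1 - t) * \<Phi> u y \<le> \<Phi> u c"
    and "\<And>u v t. u \<in> X \<Longrightarrow> v \<in> X \<Longrightarrow> 0 \<le> t \<Longrightarrow> t \<le> 1 \<Longrightarrow>
      \<exists>c\<in>X. \<forall>x\<in>K. \<Phi> c x \<le> t * \<Phi> u x + (1 - t) * \<Phi> v x"
    and "\<And>u. u \<in> X \<Longrightarrow> \<exists>x\<in>K. 0 \<le> \<Phi> u x"
  shows "\<exists>x\<in>K. \<forall>u\<in>X. 0 \<le> \<Phi> u x"
proof -
  have "\<forall>u\<in>X. \<exists>T. closed T \<and> {x \<in> K. 0 \<le> \<Phi> u x} = K \<inter> T"
    using continuous_on_nonneg_eq_Int_closed[OF cont] by metis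
  then obtain T where T: "\<And>u. u \<in> X \<Longrightarrow> closed (T u)"
    "\<And>u. u \<in> X \<Longrightarrow> {x \<in> K. 0 \<le> \<Phi> u x} = K \<inter> T u"
    by metis
  have "K \<inter> (\<Inter>u\<in>X. T u) \<noteq> {}"
  proof (rule compact_imp_fip_image[OF K(1) T(1)])
    fix U assume U: "finite U" "U \<subseteq> X"
    obtain x where "x \<in> K" "\<forall>u\<in>U. 0 \<le> \<Phi> u x"
      using fan_alternative_finite[OF U assms] by blast
    then have "x \<in> K \<inter> (\<Inter>u\<in>U. T u)" using T(2) U by blast
    then show "K \<inter> (\<Inter>u\<in>U. T u) \<noteq> {}" by blast
  qed
  then show ?thesis using T(2) by blast
qed

section \<open>Multipliers for a convergent sequence of sublinear functions\<close>

lemma sublinear_convex_combination: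
  assumes "sublinear p" "0 \<le> t" "t \<le> 1"
  shows "p (t *\<^sub>R u + (1 - t) *\<^sub>R v) \<le> t * p u + (1 - t) * p v"
proof -
  have "p (t *\<^sub>R u + (1 - t) *\<^sub>R v) \<le> p (t *\<^sub>R u) + p ((1 - t) *\<^sub>R v)"
    using assms(1) by (simp add: sublinear_def)
  also have "\<dots> = t * p u + (1 - t) * p v"
    using assms by (simp add: sublinear_def)
  finally show ?thesis .
qed

lemma sublinear_add_scaleR_le:
  assumes "sublinear p" "0 \<le> s"
  shows "p (u + s *\<^sub>R w) \<le> p u + s * p w"
  using assms by (metis sublinear_def)

text \<open>Measures on \<open>J \<union> {\<infinity>}\<close>: the coordinate \<open>0\<close> is the total mass, the coordinate \<open>Suc n\<close> the mass
  at \<open>n\<close>, and the remaining mass sits at \<open>\<infinity>\<close>, which is excluded unless \<open>at_inf\<close> (\<open>J\<close> is then finite).\<close>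

definition mass_set :: "real \<Rightarrow> nat set \<Rightarrow> bool \<Rightarrow> (nat \<Rightarrow> real) set" where
  "mass_set M J at_inf = {\<beta>. (\<forall>k. \<beta> k \<in> {0..M}) \<and> (\<forall>n. n \<in> J \<or> \<beta> (Suc n) = 0) \<and>
     (\<forall>N. (\<Sum>n<N. \<beta> (Suc n)) \<le> \<beta> 0) \<and> (at_inf \<or> \<beta> 0 = (\<Sum>n\<in>J. \<beta> (Suc n)))}"

text \<open>A product of intervals is compact by Tychonoff, and each further condition is closed
  because it involves finitely many coordinates (a sum over an infinite \<open>J\<close> is 0 by
  convention). Bounding every partial sum by \<open>\<beta> 0\<close>, instead of the series,
  achieves this.\<close>

lemma compact_mass_set: "compact (mass_set M J at_inf)"
proof -
  have "compactin (product_topology (\<lambda>_. euclidean) UNIV) (PiE UNIV (\<lambda>_ :: nat. {0..M}))"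
    by (subst compactin_PiE) auto
  then have "compact (PiE UNIV (\<lambda>_ :: nat. {0..M}))"
    by (simp add: euclidean_product_topology)
  moreover have cont: "continuous_on UNIV (\<lambda>\<beta> :: nat \<Rightarrow> real. \<beta> k)" for k
    by (rule continuous_on_product_coordinates)
  have "closed {\<beta> :: nat \<Rightarrow> real. (\<forall>n. n \<in> J \<or> \<beta> (Suc n) = 0) \<and>
     (\<forall>N. (\<Sum>n<N. \<beta> (Suc n)) \<le> \<beta> 0) \<and> (at_inf \<or> \<beta> 0 = (\<Sum>n\<in>J. \<beta> (Suc n)))}"
    by (intro closed_Collect_conj closed_Collect_all closed_Collect_disj closed_Collect_const
        closed_Collect_le closed_Collect_eq continuous_on_sum continuous_on_const cont)
  ultimately show ?thesis
    unfolding mass_set_def Collect_conj_eq[of "\<lambda>\<beta>. \<forall>k. \<beta> k \<in> {0..M}"]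
    by (simp add: compact_Int_closed PiE_UNIV_domain Pi_def)
qed

lemma mass_set_summable:
  assumes "\<beta> \<in> mass_set M J at_inf"
  shows "summable (\<lambda>n. \<beta> (Suc n))" "(\<Sum>n. \<beta> (Suc n)) \<le> \<beta> 0" "\<And>n. 0 \<le> \<beta> (Suc n)" "\<beta> 0 \<le> M"
proof -
  show nonneg: "0 \<le> \<beta> (Suc n)" for n using assms by (auto simp: mass_set_def)
  have le: "(\<Sum>n<N. \<beta> (Suc n)) \<le> \<beta> 0" for N using assms by (auto simp: mass_set_def)
  show s: "summable (\<lambda>n. \<beta> (Suc n))"
    by (rule bounded_imp_summable[where B = "\<beta> 0"]) (use nonneg le[of "Suc _"] in \<open>auto simp: lessThan_Suc_atMost\<close>)
  show "(\<Sum>n. \<beta> (Suc n)) \<le> \<beta> 0" by (rule suminf_le_const[OF s le])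
  show "\<beta> 0 \<le> M" using assms by (auto simp: mass_set_def)
qed

lemma summable_mult_bounded:
  fixes b a :: "nat \<Rightarrow> real"
  assumes "summable b" "\<And>n. 0 \<le> b n" "\<And>n. \<bar>a n\<bar> \<le> C"
  shows "summable (\<lambda>n. b n * a n)"
proof (rule summable_comparison_test')
  show "summable (\<lambda>n. b n * C)" using assms(1) by (rule summable_mult2)
  show "norm (b n * a n) \<le> b n * C" for n
    using assms(2,3) by (simp add: abs_mult mult_left_mono)
qed

text \<open>The total mass is at most \<open>M\<close>, so the tail of the series from
  \<open>N\<close> on is small uniformly in \<beta>, and the partial sums converge uniformly. The
  limit 0 makes mass drifting to infinity contribute nothing.\<close>

lemma mass_set_continuous:
  assumes d: "d \<longlonglongrightarrow> 0"
  shows "continuous_on (mass_set M J at_inf) (\<lambda>\<beta>. \<Sum>n. \<beta> (Suc n) * d n)"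
proof (rule uniform_limit_theorem)
  show "\<forall>\<^sub>F N in sequentially. continuous_on (mass_set M J at_inf) (\<lambda>\<beta>. \<Sum>n<N. \<beta> (Suc n) * d n)"
    by (intro always_eventually allI continuous_on_sum continuous_on_mult_right
        continuous_on_subset[OF continuous_on_product_coordinates]) auto
  show "uniform_limit (mass_set M J at_inf) (\<lambda>N \<beta>. \<Sum>n<N. \<beta> (Suc n) * d n)
      (\<lambda>\<beta>. \<Sum>n. \<beta> (Suc n) * d n) sequentially"
  proof (rule uniform_limitI)
    fix e :: real assume e: "0 < e"
    \<comment> \<open>The denominator is positive for any real \<open>M\<close>, and
      \<open>M * \<eta> < e\<close> follows.\<close>
    define \<eta> where "\<eta> = e / (\<bar>M\<bar> + 1)"
    have \<eta>: "0 < \<eta>" using e by (simp add: \<eta>_def)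
    obtain N0 where N0: "\<And>n. n \<ge> N0 \<Longrightarrow> \<bar>d n\<bar> < \<eta>"
      using d \<eta> unfolding LIMSEQ_iff by (metis diff_zero real_norm_def)
    obtain C where C: "\<And>n. \<bar>d n\<bar> \<le> C"
      using convergent_imp_Bseq[OF convergentI[OF d]] unfolding Bseq_def by auto
    have "dist (\<Sum>n<N. \<beta> (Suc n) * d n) (\<Sum>n. \<beta> (Suc n) * d n) < e"
      if "N0 \<le> N" and \<beta>: "\<beta> \<in> mass_set M J at_inf" for N \<beta>
    proof -
      note \<beta>' = mass_set_summable[OF \<beta>]
      have s: "summable (\<lambda>n. \<beta> (Suc n) * d n)"
        using summable_mult_bounded[OF \<beta>'(1,3) C] .
      have "(\<Sum>n. \<beta> (Suc n) * d n) = (\<Sum>n. \<beta> (Suc (n + N)) * d (n + N)) + (\<Sum>n<N. \<beta> (Suc n) * d n)"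
        by (rule suminf_split_initial_segment[OF s])
      then have "dist (\<Sum>n<N. \<beta> (Suc n) * d n) (\<Sum>n. \<beta> (Suc n) * d n)
          = \<bar>\<Sum>n. \<beta> (Suc (n + N)) * d (n + N)\<bar>"
        by (simp add: dist_real_def)
      also have "\<dots> \<le> (\<Sum>n. \<beta> (Suc (n + N)) * \<eta>)"
      proof -
        have s1: "summable (\<lambda>n. \<beta> (Suc (n + N)))"
          using summable_ignore_initial_segment[OF \<beta>'(1), of N] by simp
        have "norm (\<Sum>n. \<beta> (Suc (n + N)) * d (n + N)) \<le> (\<Sum>n. \<beta> (Suc (n + N)) * \<eta>)"
        proof (rule norm_suminf_le)
          show "summable (\<lambda>n. \<beta> (Suc (n + N)) * \<eta>)" using s1 by (rule summable_mult2)
          show "norm (\<beta> (Suc (n + N)) * d (n + N)) \<le> \<beta> (Suc (n + N)) * \<eta>" for n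
            using N0[of "n + N"] \<open>N0 \<le> N\<close> \<beta>'(3)[of "n + N"] by (simp add: abs_mult mult_left_mono)
        qed
        then show ?thesis by simp
      qed
      also have "\<dots> = (\<Sum>n. \<beta> (Suc (n + N))) * \<eta>"
        using summable_ignore_initial_segment[OF \<beta>'(1), of N] by (simp add: suminf_mult2)
      also have "\<dots> \<le> M * \<eta>"
      proof (rule mult_right_mono)
        have "(\<Sum>n. \<beta> (Suc n)) = (\<Sum>n. \<beta> (Suc (n + N))) + (\<Sum>n<N. \<beta> (Suc n))"
          by (rule suminf_split_initial_segment[OF \<beta>'(1)])
        moreover have "0 \<le> (\<Sum>n<N. \<beta> (Suc n))" using \<beta>'(3) by (simp add: sum_nonneg)
        ultimately show "(\<Sum>n. \<beta> (Suc (n + N))) \<le> M" using \<beta>'(2,4) by linarith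
      qed (use \<eta> in simp)
      also have "\<dots> < e"
      proof -
        have "M * e < (\<bar>M\<bar> + 1) * e" using e by (intro mult_strict_right_mono) auto
        then show ?thesis by (simp add: \<eta>_def field_simps)
      qed
      finally show ?thesis .
    qed
    then show "\<forall>\<^sub>F N in sequentially. \<forall>\<beta>\<in>mass_set M J at_inf.
        dist (\<Sum>n<N. \<beta> (Suc n) * d n) (\<Sum>n. \<beta> (Suc n) * d n) < e"
      unfolding eventually_sequentially by blast
  qed
qed simp

lemma mass_set_convex:
  assumes "\<beta> \<in> mass_set M J at_inf" "\<gamma> \<in> mass_set M J at_inf" "0 \<le> t" "t \<le> 1"
  shows "(\<lambda>k. t * \<beta> k + (1 - t) * \<gamma> k) \<in> mass_set M J at_inf"
proof -
  define \<eta> where "\<eta> = (\<lambda>k. t * \<beta> k + (1 - t) * \<gamma> k)"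
  have nonneg: "0 \<le> \<eta> k" if "0 \<le> \<beta> k" "0 \<le> \<gamma> k" for k
    using assms(3,4) that by (simp add: \<eta>_def)
  have upper: "\<eta> k \<le> c" if "\<beta> k \<le> c" "\<gamma> k \<le> c" for k c
    using assms(3,4) that convex_bound_le[of "\<beta> k" c "\<gamma> k" t "1 - t"] by (simp add: \<eta>_def)
  have sum: "(\<Sum>n\<in>I. \<eta> (Suc n)) = t * (\<Sum>n\<in>I. \<beta> (Suc n)) + (1 - t) * (\<Sum>n\<in>I. \<gamma> (Suc n))" for I
    by (simp add: \<eta>_def sum.distrib sum_distrib_left)
  have "(\<Sum>n<N. \<eta> (Suc n)) \<le> \<eta> 0" for N
    unfolding sum unfolding \<eta>_def
    using assms by (intro add_mono mult_left_mono) (auto simp: mass_set_def)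
  moreover have "at_inf \<or> \<eta> 0 = (\<Sum>n\<in>J. \<eta> (Suc n))"
    unfolding sum using assms(1,2) by (auto simp: mass_set_def \<eta>_def)
  moreover have "\<eta> k \<in> {0..M}" for k
    using assms(1,2) nonneg upper by (simp add: mass_set_def)
  moreover have "n \<in> J \<or> \<eta> (Suc n) = 0" for n
  proof (cases "n \<in> J")
    case False
    then have "\<beta> (Suc n) = 0" "\<gamma> (Suc n) = 0" using assms(1,2) by (auto simp: mass_set_def)
    then show ?thesis by (simp add: \<eta>_def)
  qed simp
  ultimately show ?thesis
    unfolding \<eta>_def[symmetric] mass_set_def by blast
qed

text \<open>The bound on the total mass comes from the direction \<open>w\<close>: moving from \<open>u\<close> towards \<open>w\<close>
  turns an approximately negative \<open>q n u\<close> into a negative value while \<open>p\<close> stays negative.\<close>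

lemma sublinear_multipliers:
  fixes p qi :: "'a::real_vector \<Rightarrow> real" and q :: "nat \<Rightarrow> 'a \<Rightarrow> real"
  assumes p: "sublinear p" and q: "\<And>n. sublinear (q n)"
    and lim: "\<And>u. (\<lambda>n. q n u) \<longlonglongrightarrow> qi u"
    and slater: "0 < \<delta>" "\<And>n. q n w \<le> - \<delta>"
    and J: "at_inf \<or> finite J"
    and none: "\<And>u. p u < 0 \<Longrightarrow> (\<And>n. n \<in> J \<Longrightarrow> q n u < 0) \<Longrightarrow> (at_inf \<Longrightarrow> qi u < 0) \<Longrightarrow> False"
  obtains binf b where "0 \<le> binf" "\<And>n. 0 \<le> b n" "\<And>n. n \<notin> J \<Longrightarrow> b n = 0" "\<not> at_inf \<Longrightarrow> binf = 0"
    "\<And>u. summable (\<lambda>n. b n * q n u)" "\<And>u. 0 \<le> p u + binf * qi u + (\<Sum>n. b n * q n u)"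
proof -
  have qi: "sublinear qi"
    unfolding sublinear_def
  proof (intro conjI allI impI)
    show "qi (x + y) \<le> qi x + qi y" for x y
      using q by (intro LIMSEQ_le[OF lim tendsto_add[OF lim lim]]) (auto simp: sublinear_def)
    show "qi (c *\<^sub>R x) = c * qi x" if "0 \<le> c" for x c
    proof -
      have "(\<lambda>n. q n (c *\<^sub>R x)) \<longlonglongrightarrow> c * qi x"
        using q that tendsto_mult_left[OF lim, of c x] by (simp add: sublinear_def)
      then show ?thesis using lim LIMSEQ_unique by blast
    qed
  qed
  have qiw: "qi w \<le> - \<delta>" by (rule LIMSEQ_le_const2[OF lim]) (use slater in auto)
  \<comment> \<open>The choice ensures \<open>\<bar>p w\<bar> < M * \<delta>\<close>, which later
    keeps \<open>p\<close> negative under a shift along \<open>w\<close>.\<close>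
  define M where "M = \<bar>p w\<bar> / \<delta> + 1"
  have M: "0 < M" "\<bar>p w\<bar> < M * \<delta>" using slater(1) by (auto simp: M_def field_simps)
  define K where "K = mass_set M J at_inf"
  \<comment> \<open>Written with the differences \<open>q n u - qi u\<close>, which tend to 0, so
    that each \<Phi> u is continuous on \<open>K\<close>. \<open>\<Phi>_eq\<close> rewrites it as an
    integral against the measure, with the mass at infinity weighting \<open>qi u\<close>.\<close>
  define \<Phi> where "\<Phi> = (\<lambda>u \<beta>. p u + \<beta> 0 * qi u + (\<Sum>n. \<beta> (Suc n) * (q n u - qi u)))"
  have bdd: "\<exists>C. \<forall>n. \<bar>q n u\<bar> \<le> C" for u
    using convergent_imp_Bseq[OF convergentI[OF lim[of u]]] unfolding Bseq_def by auto
  have diff: "(\<lambda>n. q n u - qi u) \<longlonglongrightarrow> 0" for u using lim[of u] by (simp add: LIM_zero)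
  have bdd': "\<exists>C. \<forall>n. \<bar>q n u - qi u\<bar> \<le> C" for u
    using convergent_imp_Bseq[OF convergentI[OF diff[of u]]] unfolding Bseq_def by auto
  have summable: "summable (\<lambda>n. \<beta> (Suc n) * q n u)" "summable (\<lambda>n. \<beta> (Suc n) * (q n u - qi u))"
    if "\<beta> \<in> K" for \<beta> u
  proof -
    note \<beta> = mass_set_summable(1,3)[OF that[unfolded K_def]]
    obtain C where "\<And>n. \<bar>q n u\<bar> \<le> C" using bdd by blast
    then show "summable (\<lambda>n. \<beta> (Suc n) * q n u)" by (rule summable_mult_bounded[OF \<beta>])
    obtain C where "\<And>n. \<bar>q n u - qi u\<bar> \<le> C" using bdd' by blast
    then show "summable (\<lambda>n. \<beta> (Suc n) * (q n u - qi u))" by (rule summable_mult_bounded[OF \<beta>])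
  qed
  have \<Phi>_eq: "\<Phi> u \<beta> = p u + (\<beta> 0 - (\<Sum>n. \<beta> (Suc n))) * qi u + (\<Sum>n. \<beta> (Suc n) * q n u)"
    if "\<beta> \<in> K" for \<beta> u
  proof -
    note \<beta> = mass_set_summable[OF that[unfolded K_def]]
    have "(\<Sum>n. \<beta> (Suc n) * (q n u - qi u)) = (\<Sum>n. \<beta> (Suc n) * q n u) - (\<Sum>n. \<beta> (Suc n) * qi u)"
      unfolding right_diff_distrib
      by (rule suminf_diff[symmetric]) (use summable(1)[OF that] summable_mult2[OF \<beta>(1)] in auto)
    also have "(\<Sum>n. \<beta> (Suc n) * qi u) = (\<Sum>n. \<beta> (Suc n)) * qi u"
      by (rule suminf_mult2[OF \<beta>(1), symmetric])
    finally show ?thesis by (simp add: \<Phi>_def algebra_simps)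
  qed
  have "\<exists>\<beta>\<in>K. \<forall>u\<in>UNIV. 0 \<le> \<Phi> u \<beta>"
  proof (rule fan_alternative)
    show "compact K" unfolding K_def by (rule compact_mass_set)
    have zero: "(\<lambda>_. 0) \<in> K" using M by (simp add: K_def mass_set_def)
    then show "K \<noteq> {}" by blast
    show "continuous_on K (\<Phi> u)" for u
      unfolding \<Phi>_def K_def
      by (intro continuous_intros continuous_on_mult_right mass_set_continuous[OF diff]
          continuous_on_subset[OF continuous_on_product_coordinates]) auto
    show "\<exists>\<gamma>\<in>K. \<forall>u\<in>UNIV. t * \<Phi> u \<alpha> + (1 - t) * \<Phi> u \<beta> \<le> \<Phi> u \<gamma>"
      if "\<alpha> \<in> K" "\<beta> \<in> K" "0 \<le> t" "t \<le> 1" for \<alpha> \<beta> t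
    proof
      let ?\<gamma> = "\<lambda>k. t * \<alpha> k + (1 - t) * \<beta> k"
      show "?\<gamma> \<in> K" using mass_set_convex that unfolding K_def by blast
      have "\<Phi> u ?\<gamma> = t * \<Phi> u \<alpha> + (1 - t) * \<Phi> u \<beta>" for u
      proof -
        have "(\<Sum>n. ?\<gamma> (Suc n) * (q n u - qi u))
            = (\<Sum>n. t * (\<alpha> (Suc n) * (q n u - qi u)) + (1 - t) * (\<beta> (Suc n) * (q n u - qi u)))"
          by (simp add: algebra_simps)
        also have "\<dots> = t * (\<Sum>n. \<alpha> (Suc n) * (q n u - qi u)) + (1 - t) * (\<Sum>n. \<beta> (Suc n) * (q n u - qi u))"
          using summable(2)[OF that(1), of u] summable(2)[OF that(2), of u]
          by (simp only: suminf_add[symmetric] suminf_mult summable_mult)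
        finally show ?thesis by (simp add: \<Phi>_def algebra_simps)
      qed
      then show "\<forall>u\<in>UNIV. t * \<Phi> u \<alpha> + (1 - t) * \<Phi> u \<beta> \<le> \<Phi> u ?\<gamma>" by simp
    qed
    \<comment> \<open>Convexity in the direction is visible in the form \<open>\<Phi>_eq\<close>,
      where \<open>qi\<close> and all \<open>q n\<close> carry nonnegative weights.\<close>
    show "\<exists>c\<in>UNIV. \<forall>\<beta>\<in>K. \<Phi> c \<beta> \<le> t * \<Phi> u \<beta> + (1 - t) * \<Phi> v \<beta>"
      if t: "0 \<le> t" "t \<le> 1" for u v t
    proof (intro bexI ballI)
      fix \<beta> assume \<beta>: "\<beta> \<in> K"
      let ?c = "t *\<^sub>R u + (1 - t) *\<^sub>R v" and ?m = "\<beta> 0 - (\<Sum>n. \<beta> (Suc n))"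
      note \<beta>' = mass_set_summable[OF \<beta>[unfolded K_def]]
      have "(\<Sum>n. \<beta> (Suc n) * q n ?c) \<le> (\<Sum>n. t * (\<beta> (Suc n) * q n u) + (1 - t) * (\<beta> (Suc n) * q n v))"
      proof (rule suminf_le)
        show "\<beta> (Suc n) * q n ?c \<le> t * (\<beta> (Suc n) * q n u) + (1 - t) * (\<beta> (Suc n) * q n v)" for n
          using mult_left_mono[OF sublinear_convex_combination[OF q t, of n u v] \<beta>'(3)[of n]]
          by (simp add: algebra_simps)
        show "summable (\<lambda>n. \<beta> (Suc n) * q n ?c)"
          "summable (\<lambda>n. t * (\<beta> (Suc n) * q n u) + (1 - t) * (\<beta> (Suc n) * q n v))"
          using summable(1)[OF \<beta>] by (auto intro!: summable_add summable_mult)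
      qed
      also have "\<dots> = t * (\<Sum>n. \<beta> (Suc n) * q n u) + (1 - t) * (\<Sum>n. \<beta> (Suc n) * q n v)"
        using summable(1)[OF \<beta>, of u] summable(1)[OF \<beta>, of v]
        by (simp only: suminf_add[symmetric] suminf_mult summable_mult)
      finally have 1: "(\<Sum>n. \<beta> (Suc n) * q n ?c) \<le> \<dots>" .
      have "?m * qi ?c \<le> ?m * (t * qi u + (1 - t) * qi v)"
        using sublinear_convex_combination[OF qi t] \<beta>'(2) by (intro mult_left_mono) auto
      then show "\<Phi> ?c \<beta> \<le> t * \<Phi> u \<beta> + (1 - t) * \<Phi> v \<beta>"
        using 1 sublinear_convex_combination[OF p t, of u v]
        unfolding \<Phi>_eq[OF \<beta>] by (simp add: algebra_simps)
    qed simp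
    show "\<exists>\<beta>\<in>K. 0 \<le> \<Phi> u \<beta>" for u
    proof (rule ccontr)
      \<comment> \<open>Testing \<open>neg\<close> on the zero measure and on mass \<open>M\<close>
        at a single n in \<open>J\<close>, or at infinity, gives \<open>p u < 0\<close> and the
        upper bound \<open>- p u / M\<close> for \<open>q n u\<close> and \<open>qi u\<close>. This
        bound is positive; the shift along \<open>w\<close> absorbs it.\<close>
      assume neg: "\<not> (\<exists>\<beta>\<in>K. 0 \<le> \<Phi> u \<beta>)"
      have pu: "p u < 0"
      proof -
        have "\<Phi> u (\<lambda>_. 0) < 0" using zero neg by force
        then show ?thesis by (simp add: \<Phi>_def)
      qed
      have J_neg: "M * q n u < - p u" if "n \<in> J" for n
      proof -
        \<comment> \<open>Mass \<open>M\<close> at n: coordinate 0 holds the total mass, so it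
          equals \<open>M\<close> as well.\<close>
        define \<beta> where "\<beta> = (\<lambda>k. if k = 0 \<or> k = Suc n then M else 0)"
        have \<beta>_Suc: "\<beta> (Suc k) = (if k = n then M else 0)" for k by (simp add: \<beta>_def)
        have "\<beta> \<in> K"
          using that M J unfolding K_def mass_set_def by (auto simp: \<beta>_Suc) (auto simp: \<beta>_def)
        then have "\<Phi> u \<beta> < 0" using neg by force
        moreover have "(\<Sum>k. \<beta> (Suc k) * (q k u - qi u)) = M * (q n u - qi u)"
          using suminf_finite[of "{n}" "\<lambda>k. \<beta> (Suc k) * (q k u - qi u)"] by (simp add: \<beta>_Suc)
        ultimately show ?thesis by (simp add: \<Phi>_def \<beta>_def algebra_simps)
      qed
      have inf_neg: "M * qi u < - p u" if "at_inf"
      proof -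
        \<comment> \<open>Total mass \<open>M\<close> and none at any n: everything sits at
          infinity.\<close>
        define \<beta> where "\<beta> = (\<lambda>k. if k = (0::nat) then M else 0)"
        have "\<beta> \<in> K" using that M unfolding K_def mass_set_def by (auto simp: \<beta>_def)
        then have "\<Phi> u \<beta> < 0" using neg by force
        then show ?thesis by (simp add: \<Phi>_def \<beta>_def)
      qed
      \<comment> \<open>With this \<open>s\<close> the gain \<open>s * \<delta>\<close> equals
        \<open>- p u / M\<close>, exactly the excess allowed above, while the loss
        \<open>s * \<bar>p w\<bar>\<close> in \<open>p\<close> is less than
        \<open>s * (M * \<delta>) = - p u\<close>.\<close>
      define s where "s = - p u / (M * \<delta>)"
      have s: "0 < s" using pu M slater unfolding s_def by (intro divide_pos_pos mult_pos_pos) auto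
      have neg': "r (u + s *\<^sub>R w) < 0" if "sublinear r" "r w \<le> - \<delta>" "M * r u < - p u" for r
      proof -
        have "r (u + s *\<^sub>R w) \<le> r u + s * r w" using that s by (intro sublinear_add_scaleR_le) auto
        also have "\<dots> \<le> r u - s * \<delta>" using mult_left_mono[OF that(2), of s] s by simp
        also have "\<dots> < 0" using that(3) M slater by (simp add: s_def field_simps)
        finally show ?thesis .
      qed
      have "p (u + s *\<^sub>R w) < 0"
      proof -
        have "p (u + s *\<^sub>R w) \<le> p u + s * p w" using p s by (intro sublinear_add_scaleR_le) auto
        also have "s * p w \<le> s * \<bar>p w\<bar>" using s by (intro mult_left_mono) auto
        also have "s * \<bar>p w\<bar> < s * (M * \<delta>)" using s M by (intro mult_strict_left_mono) auto
        also have "s * (M * \<delta>) = - p u" using M slater by (simp add: s_def)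
        finally show ?thesis by simp
      qed
      then show False
        using neg'[OF q slater(2) J_neg] neg'[OF qi qiw inf_neg] by (rule none)
    qed
  qed
  then obtain \<beta> where \<beta>: "\<beta> \<in> K" "\<And>u. 0 \<le> \<Phi> u \<beta>" by blast
  note \<beta>' = mass_set_summable[OF \<beta>(1)[unfolded K_def]]
  \<comment> \<open>\<open>binf\<close> is the mass missing from the integers, \<open>b n\<close>
    the mass at n. Without \<open>at_inf\<close>, \<open>J\<close> is finite and the total equals
    the sum over \<open>J\<close>, so nothing is missing.\<close>
  show thesis
  proof
    show "0 \<le> \<beta> 0 - (\<Sum>n. \<beta> (Suc n))" using \<beta>'(2) by simp
    show "0 \<le> \<beta> (Suc n)" for n by (rule \<beta>'(3))
    show J0: "\<beta> (Suc n) = 0" if "n \<notin> J" for n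
      using \<beta>(1) that by (auto simp: K_def mass_set_def)
    show "\<beta> 0 - (\<Sum>n. \<beta> (Suc n)) = 0" if "\<not> at_inf"
      using \<beta>(1) that J suminf_finite[of J "\<lambda>n. \<beta> (Suc n)"] J0 by (auto simp: K_def mass_set_def)
    show "summable (\<lambda>n. \<beta> (Suc n) * q n u)" for u by (rule summable(1)[OF \<beta>(1)])
    show "0 \<le> p u + (\<beta> 0 - (\<Sum>n. \<beta> (Suc n))) * qi u + (\<Sum>n. \<beta> (Suc n) * q n u)" for u
      using \<beta>(2)[of u] \<Phi>_eq[OF \<beta>(1)] by simp
  qed
qed

section \<open>Directional derivatives of convex functions\<close>

abbreviation diff_quotient :: "('a::real_normed_vector \<Rightarrow> real) \<Rightarrow> 'a \<Rightarrow> 'a \<Rightarrow> real \<Rightarrow> real" where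
  "diff_quotient f x u t \<equiv> (f (x + t *\<^sub>R u) - f x) / t"

lemma eventually_line_in_open:
  fixes x u :: "'a::real_normed_vector"
  assumes "open S" "x \<in> S"
  shows "\<forall>\<^sub>F t in at_right 0. x + t *\<^sub>R u \<in> S"
proof -
  have "((\<lambda>t::real. x + t *\<^sub>R u) \<longlongrightarrow> x + 0 *\<^sub>R u) (at_right 0)"
    by (intro tendsto_intros)
  then show ?thesis using assms by (simp add: topological_tendstoD)
qed

lemma convex_on_quotient_mono:
  assumes f: "convex_on S f" and x: "x \<in> S" "x + t *\<^sub>R u \<in> S" and s: "0 < s" "s \<le> t"
  shows "diff_quotient f x u s \<le> diff_quotient f x u t"
proof -
  have "f ((1 - s / t) *\<^sub>R x + (s / t) *\<^sub>R (x + t *\<^sub>R u)) \<le> (1 - s / t) * f x + s / t * f (x + t *\<^sub>R u)"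
    by (rule convex_onD[OF f]) (use x s in auto)
  also have "(1 - s / t) *\<^sub>R x + (s / t) *\<^sub>R (x + t *\<^sub>R u) = x + s *\<^sub>R u"
    using s by (simp add: algebra_simps)
  finally have "f (x + s *\<^sub>R u) - f x \<le> s * diff_quotient f x u t"
    by (simp add: algebra_simps diff_divide_distrib)
  then show ?thesis using s(1) by (simp add: divide_le_eq mult.commute)
qed

text \<open>\<open>x\<close> is the convex combination of \<open>x - s *\<^sub>R u\<close> and
  \<open>x + t *\<^sub>R u\<close> with weights \<open>t / (s + t)\<close> and
  \<open>s / (s + t)\<close>. Fixing \<open>s\<close> bounds all forward quotients from below by one
  number.\<close>

lemma convex_on_quotient_lower_bound:
  assumes f: "convex_on S f" and x: "x + t *\<^sub>R u \<in> S" "x - s *\<^sub>R u \<in> S" and s: "0 < s" "0 < t"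
  shows "- ((f (x - s *\<^sub>R u) - f x) / s) \<le> diff_quotient f x u t"
proof -
  have "f ((1 - s / (s + t)) *\<^sub>R (x - s *\<^sub>R u) + (s / (s + t)) *\<^sub>R (x + t *\<^sub>R u))
      \<le> (1 - s / (s + t)) * f (x - s *\<^sub>R u) + s / (s + t) * f (x + t *\<^sub>R u)"
    by (rule convex_onD[OF f]) (use x s in auto)
  also have "(1 - s / (s + t)) *\<^sub>R (x - s *\<^sub>R u) + (s / (s + t)) *\<^sub>R (x + t *\<^sub>R u)
      = x + (s / (s + t) * t - (1 - s / (s + t)) * s) *\<^sub>R u"
    by (simp add: algebra_simps)
  also have eq: "1 - s / (s + t) = t / (s + t)" using s by (simp add: field_simps)
  also have "s / (s + t) * t - t / (s + t) * s = 0" by simp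
  finally have "f x \<le> t / (s + t) * f (x - s *\<^sub>R u) + s / (s + t) * f (x + t *\<^sub>R u)" by simp
  then have "f x \<le> (t * f (x - s *\<^sub>R u) + s * f (x + t *\<^sub>R u)) / (s + t)"
    by (simp add: add_divide_distrib)
  then have "(s + t) * f x \<le> t * f (x - s *\<^sub>R u) + s * f (x + t *\<^sub>R u)"
    using s by (simp add: le_divide_eq mult.commute)
  then have "- (t * (f (x - s *\<^sub>R u) - f x)) \<le> s * (f (x + t *\<^sub>R u) - f x)"
    by (simp add: algebra_simps)
  then show ?thesis using s by (simp add: field_simps)
qed

text \<open>The quotients decrease as \<open>t\<close> decreases and are bounded below by a backward
  quotient, so they converge to their infimum \<open>l\<close>.\<close>

lemma convex_on_dplus:
  fixes f :: "'a::real_normed_vector \<Rightarrow> real"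
  assumes f: "convex_on S f" and S: "open S" "x \<in> S"
  shows convex_on_tendsto_dplus: "(diff_quotient f x u \<longlongrightarrow> dplus f x u) (at_right 0)"
    and convex_on_dplus_le: "0 < t \<Longrightarrow> x + t *\<^sub>R u \<in> S \<Longrightarrow> dplus f x u \<le> diff_quotient f x u t"
proof -
  define T where "T = {t. 0 < t \<and> x + t *\<^sub>R u \<in> S}"
  define l where "l = Inf (diff_quotient f x u ` T)"
  have ev: "\<forall>\<^sub>F t in at_right 0. t \<in> T"
    using eventually_line_in_open[OF S, of u] eventually_at_right_less[of 0]
    by eventually_elim (simp add: T_def)
  then have "T \<noteq> {}"
    using eventually_happens'[OF trivial_limit_at_right_real ev] by auto
  have "\<forall>\<^sub>F s in at_right 0. 0 < s \<and> x - s *\<^sub>R u \<in> S"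
    using eventually_line_in_open[OF S, of "- u"] eventually_at_right_less[of 0]
    by eventually_elim simp
  then obtain s where "0 < s" "x - s *\<^sub>R u \<in> S"
    using eventually_happens'[OF trivial_limit_at_right_real] by blast
  then have bdd: "bdd_below (diff_quotient f x u ` T)"
    by (intro bdd_belowI[of _ "- ((f (x - s *\<^sub>R u) - f x) / s)"])
      (auto simp: T_def intro!: convex_on_quotient_lower_bound[OF f])
  have lower: "l \<le> diff_quotient f x u t" if "t \<in> T" for t
    unfolding l_def using that by (intro cINF_lower bdd)
  have lim: "(diff_quotient f x u \<longlongrightarrow> l) (at_right 0)"
  proof (rule order_tendstoI)
    fix a assume "a < l"
    show "\<forall>\<^sub>F t in at_right 0. a < diff_quotient f x u t"
      using ev by eventually_elim (use lower \<open>a < l\<close> in force)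
  next
    fix a assume "l < a"
    then obtain t where t: "t \<in> T" "diff_quotient f x u t < a"
      using \<open>T \<noteq> {}\<close> bdd unfolding l_def by (subst (asm) cINF_less_iff) auto
    have "\<forall>\<^sub>F s in at_right 0. s < t"
      using t(1) by (intro eventually_at_right_real[THEN eventually_mono]) (auto simp: T_def)
    then show "\<forall>\<^sub>F s in at_right 0. diff_quotient f x u s < a"
      using eventually_at_right_less[of 0]
    proof eventually_elim
      case (elim s)
      then have "diff_quotient f x u s \<le> diff_quotient f x u t"
        using t(1) S by (intro convex_on_quotient_mono[OF f]) (auto simp: T_def)
      then show ?case using t(2) by simp
    qed
  qed
  have "dplus f x u = l"
    unfolding dplus_def by (rule tendsto_Lim[OF trivial_limit_at_right_real lim])
  with lim lower show "(diff_quotient f x u \<longlongrightarrow> dplus f x u) (at_right 0)"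
    "0 < t \<Longrightarrow> x + t *\<^sub>R u \<in> S \<Longrightarrow> dplus f x u \<le> diff_quotient f x u t"
    by (auto simp: T_def)
qed

lemma convex_on_dplus_le_diff:
  assumes "convex_on S f" "open S" "x \<in> S" "y \<in> S"
  shows "dplus f x (y - x) \<le> f y - f x"
  using convex_on_dplus_le[OF assms(1-3), of 1 "y - x"] assms(4) by simp

section \<open>Consequences of property (H) near \<open>z\<close>\<close>

lemma le_lip_seminorm:
  assumes "x \<in> S" "y \<in> S"
  shows "ennreal \<bar>h x - h y\<bar> \<le> lip_seminorm S h * ennreal (norm (x - y))"
proof (cases "x = y")
  case False
  then have "ennreal (\<bar>h x - h y\<bar> / norm (x - y)) \<le> lip_seminorm S h"
    unfolding lip_seminorm_def using assms by (intro SUP_upper2[of "(x, y)"]) auto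
  then have "ennreal (\<bar>h x - h y\<bar> / norm (x - y)) * ennreal (norm (x - y))
      \<le> lip_seminorm S h * ennreal (norm (x - y))"
    by (rule mult_right_mono) simp
  with False show ?thesis by (simp flip: ennreal_mult)
qed simp

text \<open>Property (H) with real constants on a ball of finite radius: \<open>C\<close> is a Lipschitz constant common
  to all \<open>f n\<close>, and \<open>e n\<close> is the seminorm of \<open>f n - finf\<close>, which is finite for large \<open>n\<close>.\<close>

locale convex_family =
  fixes \<Omega> :: "'a::real_normed_vector set" and f :: "nat \<Rightarrow> 'a \<Rightarrow> real" and finf :: "'a \<Rightarrow> real"
    and z :: 'a and \<rho> C :: real and e :: "nat \<Rightarrow> real"
  assumes \<Omega>: "open \<Omega>"
    and f: "\<And>n. convex_on \<Omega> (f n)"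
    and \<rho>: "0 < \<rho>" "ball z \<rho> \<subseteq> \<Omega>"
    and lipschitz: "\<And>n x y. x \<in> ball z \<rho> \<Longrightarrow> y \<in> ball z \<rho> \<Longrightarrow> \<bar>f n x - f n y\<bar> \<le> C * norm (x - y)"
    and limit: "(\<lambda>n. f n z) \<longlonglongrightarrow> finf z"
    and e: "e \<longlonglongrightarrow> 0"
    and uniform: "\<forall>\<^sub>F n in sequentially. \<forall>x\<in>ball z \<rho>. \<forall>y\<in>ball z \<rho>.
      \<bar>(f n x - finf x) - (f n y - finf y)\<bar> \<le> e n * norm (x - y)"
begin

lemma z: "z \<in> \<Omega>" "z \<in> ball z \<rho>"
  using \<rho> by auto

text \<open>The values of \<open>f n - finf\<close> at \<open>x\<close> and \<open>z\<close> differ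
  by at most \<open>e n * norm (x - z)\<close>, so convergence at \<open>z\<close> propagates to the
  ball.\<close>

lemma limit_ball:
  assumes x: "x \<in> ball z \<rho>"
  shows "(\<lambda>n. f n x) \<longlonglongrightarrow> finf x"
proof -
  have "(\<lambda>n. (f n x - finf x) - (f n z - finf z)) \<longlonglongrightarrow> 0"
  proof (rule Lim_null_comparison)
    show "\<forall>\<^sub>F n in sequentially. norm ((f n x - finf x) - (f n z - finf z)) \<le> e n * norm (x - z)"
      using uniform by eventually_elim (use x z in auto)
    show "(\<lambda>n. e n * norm (x - z)) \<longlonglongrightarrow> 0"
      using tendsto_mult_right[OF e] by simp
  qed
  then have "(\<lambda>n. (f n x - finf x) - (f n z - finf z) + (finf x - finf z) + f n z)
      \<longlonglongrightarrow> 0 + (finf x - finf z) + finf z"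
    by (intro tendsto_intros limit)
  then show ?thesis by simp
qed

text \<open>Convexity passes to pointwise limits; the limit is known on this ball, hence the
  domain.\<close>

lemma convex_on_finf: "convex_on (ball z \<rho>) finf"
proof (rule convex_onI)
  fix t :: real and x y assume t: "0 < t" "t < 1" and xy: "x \<in> ball z \<rho>" "y \<in> ball z \<rho>"
  let ?c = "(1 - t) *\<^sub>R x + t *\<^sub>R y"
  have c: "?c \<in> ball z \<rho>" using convexD_alt[OF convex_ball xy] t by auto
  show "finf ?c \<le> (1 - t) * finf x + t * finf y"
  proof (rule LIMSEQ_le[OF limit_ball[OF c]])
    show "(\<lambda>n. (1 - t) * f n x + t * f n y) \<longlonglongrightarrow> (1 - t) * finf x + t * finf y"
      by (intro tendsto_intros limit_ball xy)
    show "\<exists>N. \<forall>n\<ge>N. f n ?c \<le> (1 - t) * f n x + t * f n y"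
      using convex_onD[OF f] t xy \<rho> by (auto simp: subset_iff)
  qed
qed simp

lemma tendsto_quotient: "(diff_quotient (f n) z u \<longlongrightarrow> dplus (f n) z u) (at_right 0)"
  by (rule convex_on_tendsto_dplus[OF f \<Omega> z(1)])

lemma tendsto_quotient_finf: "(diff_quotient finf z u \<longlongrightarrow> dplus finf z u) (at_right 0)"
  by (rule convex_on_tendsto_dplus[OF convex_on_finf open_ball z(2)])

lemma eventually_line_in_ball: "\<forall>\<^sub>F t in at_right 0. 0 < t \<and> z + t *\<^sub>R u \<in> ball z \<rho>"
  using eventually_line_in_open[OF open_ball z(2), of u] eventually_at_right_less[of 0]
  by eventually_elim simp

text \<open>The step \<open>t\<close> cancels from the Lipschitz estimate for
  \<open>f n - finf\<close>, which leaves a bound independent of \<open>t\<close>.\<close>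

lemma quotient_uniform:
  "\<forall>\<^sub>F n in sequentially. \<forall>t>0. z + t *\<^sub>R u \<in> ball z \<rho> \<longrightarrow>
     \<bar>diff_quotient (f n) z u t - diff_quotient finf z u t\<bar> \<le> e n * norm u"
  using uniform
proof eventually_elim
  case (elim n)
  show ?case
  proof (intro allI impI)
    fix t :: real assume t: "0 < t" "z + t *\<^sub>R u \<in> ball z \<rho>"
    have "\<bar>diff_quotient (f n) z u t - diff_quotient finf z u t\<bar>
        = \<bar>(f n (z + t *\<^sub>R u) - finf (z + t *\<^sub>R u)) - (f n z - finf z)\<bar> / t"
      using t(1) by (simp add: algebra_simps flip: diff_divide_distrib)
    also have "\<dots> \<le> e n * norm (t *\<^sub>R u) / t"
      using elim t z by (intro divide_right_mono) fastforce+
    also have "\<dots> = e n * norm u" using t(1) by simp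
    finally show "\<bar>diff_quotient (f n) z u t - diff_quotient finf z u t\<bar> \<le> e n * norm u" .
  qed
qed

lemma dplus_uniform:
  "\<forall>\<^sub>F n in sequentially. \<bar>dplus (f n) z u - dplus finf z u\<bar> \<le> e n * norm u"
  using quotient_uniform[of u]
proof eventually_elim
  case (elim n)
  show ?case
  proof (rule tendsto_upperbound)
    show "((\<lambda>t. \<bar>diff_quotient (f n) z u t - diff_quotient finf z u t\<bar>) \<longlongrightarrow>
        \<bar>dplus (f n) z u - dplus finf z u\<bar>) (at_right 0)"
      by (intro tendsto_intros tendsto_quotient tendsto_quotient_finf)
    show "\<forall>\<^sub>F t in at_right 0. \<bar>diff_quotient (f n) z u t - diff_quotient finf z u t\<bar> \<le> e n * norm u"
      using eventually_line_in_ball[of u] by eventually_elim (use elim in auto)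
  qed simp
qed

lemma tendsto_dplus: "(\<lambda>n. dplus (f n) z u) \<longlonglongrightarrow> dplus finf z u"
proof -
  have "(\<lambda>n. e n * norm u) \<longlonglongrightarrow> 0" using tendsto_mult_right[OF e] by simp
  then have "(\<lambda>n. dplus (f n) z u - dplus finf z u) \<longlonglongrightarrow> 0"
    by (rule Lim_null_comparison[rotated]) (use dplus_uniform in simp)
  then show ?thesis by (simp add: LIM_zero_iff)
qed

text \<open>Provides one range of \<open>t\<close> valid for all large \<open>n\<close> at once: for
  small \<open>t\<close> the quotient of \<open>finf\<close> is below the midpoint \<open>m\<close>,
  and from \<open>N\<close> on the error \<open>e n * norm u\<close> is below the remaining gap
  \<open>c - m\<close>.\<close>

lemma quotient_uniformly_less:
  assumes "dplus finf z u < c"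
  obtains N where "\<forall>\<^sub>F t in at_right 0. \<forall>n\<ge>N. diff_quotient (f n) z u t < c"
proof -
  define m where "m = (dplus finf z u + c) / 2"
  have m: "dplus finf z u < m" "m < c" using assms by (auto simp: m_def)
  have "(\<lambda>n. e n * norm u) \<longlonglongrightarrow> 0" using tendsto_mult_right[OF e] by simp
  then have "\<forall>\<^sub>F n in sequentially. e n * norm u < c - m"
    using m by (intro order_tendstoD) auto
  then have "\<forall>\<^sub>F n in sequentially. \<forall>t>0. z + t *\<^sub>R u \<in> ball z \<rho> \<longrightarrow>
      diff_quotient (f n) z u t < diff_quotient finf z u t + (c - m)"
    using quotient_uniform[of u]
  proof eventually_elim
    case (elim n)
    show ?case
    proof (intro allI impI)
      fix t :: real assume "0 < t" "z + t *\<^sub>R u \<in> ball z \<rho>"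
      with elim have "\<bar>diff_quotient (f n) z u t - diff_quotient finf z u t\<bar> < c - m" by fastforce
      then show "diff_quotient (f n) z u t < diff_quotient finf z u t + (c - m)" by linarith
    qed
  qed
  then obtain N where N: "\<And>n t. n \<ge> N \<Longrightarrow> 0 < t \<Longrightarrow> z + t *\<^sub>R u \<in> ball z \<rho> \<Longrightarrow>
      diff_quotient (f n) z u t < diff_quotient finf z u t + (c - m)"
    unfolding eventually_sequentially by blast
  have "\<forall>\<^sub>F t in at_right 0. diff_quotient finf z u t < m"
    by (rule order_tendstoD(2)[OF tendsto_quotient_finf m(1)])
  then have "\<forall>\<^sub>F t in at_right 0. \<forall>n\<ge>N. diff_quotient (f n) z u t < c"
    using eventually_line_in_ball[of u]
  proof eventually_elim
    case (elim t)
    then show ?case using N[of _ t] by fastforce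
  qed
  then show thesis by (rule that)
qed

lemma value_le:
  assumes "0 < t" "z + t *\<^sub>R u \<in> ball z \<rho>"
  shows "f n (z + t *\<^sub>R u) \<le> f n z + t * (C * norm u)"
  using lipschitz[OF assms(2) z(2), of n] assms(1) by (simp add: algebra_simps abs_le_iff)

lemma quotient_bounded:
  assumes "0 < t" "z + t *\<^sub>R u \<in> ball z \<rho>"
  shows "\<bar>diff_quotient (f n) z u t\<bar> \<le> C * norm u"
  using lipschitz[OF assms(2) z(2), of n] assms(1) by (simp add: divide_le_eq algebra_simps)

text \<open>The common Lipschitz constant \<open>C\<close> makes the threshold for \<open>t\<close>
  independent of \<open>n\<close>.\<close>

lemma eventually_value_le:
  assumes "0 < d"
  shows "\<forall>\<^sub>F t in at_right 0. \<forall>n. f n (z + t *\<^sub>R u) \<le> f n z + d"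
proof -
  have "((\<lambda>t. t * (C * norm u)) \<longlongrightarrow> 0 * (C * norm u)) (at_right 0)"
    by (intro tendsto_intros)
  then have "\<forall>\<^sub>F t in at_right 0. t * (C * norm u) < d"
    using assms by (intro order_tendstoD) auto
  then show ?thesis
    using eventually_line_in_ball[of u]
    by eventually_elim (use value_le in \<open>fastforce intro: order_trans\<close>)
qed

lemma finf_nonpos:
  assumes "feasible \<Omega> f z"
  shows "finf z \<le> 0"
  by (rule LIMSEQ_le_const2[OF limit]) (use assms in \<open>auto simp: feasible_def\<close>)

text \<open>Along a short step in the direction \<open>u\<close>, a single constraint survives by
  its derivative if active and by continuity if not; a uniform argument covers the tail, so only
  finitely many separate thresholds for \<open>t\<close> remain.\<close>

lemma strict_descent:
  assumes feas: "feasible \<Omega> f z" and f0: "dplus (f 0) z u < 0"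
    and active: "\<And>n. n \<ge> 1 \<Longrightarrow> f n z = 0 \<Longrightarrow> dplus (f n) z u < 0"
    and active_inf: "finf z = 0 \<Longrightarrow> dplus finf z u < 0"
  shows "\<exists>x. feasible \<Omega> f x \<and> f 0 x < f 0 z"
proof -
  have neg: "\<forall>\<^sub>F t in at_right 0. f n (z + t *\<^sub>R u) < f n z" if "dplus (f n) z u < 0" for n
    using order_tendstoD(2)[OF tendsto_quotient that] eventually_at_right_less[of 0]
    by eventually_elim (simp add: divide_less_0_iff)
  have each: "\<forall>\<^sub>F t in at_right 0. f n (z + t *\<^sub>R u) \<le> 0" if "n \<ge> 1" for n
  proof (cases "f n z = 0")
    case True
    show ?thesis using neg[OF active[OF that True]] by eventually_elim (simp add: True)
  next
    case False
    then have "f n z < 0" using feas that by (force simp: feasible_def)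
    then show ?thesis
      using eventually_value_le[of "- f n z" u] by (auto elim!: eventually_mono dest: spec[of _ n])
  qed
  \<comment> \<open>If \<open>finf z = 0\<close>, the quotients of all late \<open>f n\<close> are
    uniformly negative. If \<open>finf z < 0\<close>, their values at \<open>z\<close> stay below
    \<open>finf z / 2\<close> and rise by at most \<open>- finf z / 2\<close>. The bound
    \<open>max N 1\<close> skips the objective.\<close>
  obtain N where N: "\<forall>\<^sub>F t in at_right 0. \<forall>n\<ge>max N 1. f n (z + t *\<^sub>R u) \<le> 0"
  proof (cases "finf z = 0")
    case True
    obtain N where "\<forall>\<^sub>F t in at_right 0. \<forall>n\<ge>N. diff_quotient (f n) z u t < 0"
      using quotient_uniformly_less[OF active_inf[OF True]] .
    then have "\<forall>\<^sub>F t in at_right 0. \<forall>n\<ge>max N 1. f n (z + t *\<^sub>R u) \<le> 0"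
      using eventually_at_right_less[of 0]
    proof eventually_elim
      case (elim t)
      show ?case
      proof (intro allI impI)
        fix n assume n: "max N 1 \<le> n"
        then have "f n (z + t *\<^sub>R u) < f n z" using elim by (auto simp: divide_less_0_iff)
        then show "f n (z + t *\<^sub>R u) \<le> 0" using feas n by (force simp: feasible_def)
      qed
    qed
    then show thesis by (rule that)
  next
    case False
    then have fz: "finf z < 0" using finf_nonpos[OF feas] by simp
    then have "\<forall>\<^sub>F n in sequentially. f n z < finf z / 2"
      by (intro order_tendstoD(2)[OF limit]) simp
    then obtain N where N: "\<And>n. n \<ge> N \<Longrightarrow> f n z < finf z / 2"
      unfolding eventually_sequentially by blast
    have "\<forall>\<^sub>F t in at_right 0. \<forall>n. f n (z + t *\<^sub>R u) \<le> f n z + (- finf z / 2)"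
      using fz by (intro eventually_value_le) simp
    then have "\<forall>\<^sub>F t in at_right 0. \<forall>n\<ge>max N 1. f n (z + t *\<^sub>R u) \<le> 0"
    proof eventually_elim
      case (elim t)
      show ?case
      proof (intro allI impI)
        fix n assume "max N 1 \<le> n"
        then show "f n (z + t *\<^sub>R u) \<le> 0" using N[of n] spec[OF elim, of n] by simp
      qed
    qed
    then show thesis by (rule that)
  qed
  have "\<forall>\<^sub>F t in at_right 0. \<forall>n\<in>{1..<max N 1}. f n (z + t *\<^sub>R u) \<le> 0"
    by (rule eventually_ball_finite) (use each in auto)
  then have "\<forall>\<^sub>F t in at_right 0. feasible \<Omega> f (z + t *\<^sub>R u) \<and> f 0 (z + t *\<^sub>R u) < f 0 z"
    using N neg[OF f0] eventually_line_in_ball[of u]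
  proof eventually_elim
    case (elim t)
    have "f n (z + t *\<^sub>R u) \<le> 0" if "n \<ge> 1" for n
      using elim(1,2) that by (cases "n < max N 1") auto
    then show ?case using elim(3,4) \<rho>(2) by (auto simp: feasible_def)
  qed
  then show ?thesis
    using eventually_happens'[OF trivial_limit_at_right_real] by blast
qed

end

text \<open>The ball is shrunk to a finite radius inside \<Omega>. A common Lipschitz constant comes
  from that of \<open>finf\<close> for large \<open>n\<close> and from finitely many individual
  constants otherwise.\<close>

lemma property_H_convex_family:
  assumes \<Omega>: "open \<Omega>" and f: "\<And>n. convex_on \<Omega> (f n)" and z: "z \<in> \<Omega>"
    and H: "property_H \<Omega> f z finf"
  obtains \<rho> C e where "convex_family \<Omega> f finf z \<rho> C e"
proof -
  obtain r :: ereal and L' where r: "0 < r"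
    and L: "\<And>n. \<exists>L. L-lipschitz_on (eball z r \<inter> \<Omega>) (f n)"
    and L': "L'-lipschitz_on (eball z r \<inter> \<Omega>) finf"
    and lim: "(\<lambda>n. f n z) \<longlonglongrightarrow> finf z"
    and semi: "(\<lambda>n. lip_seminorm (eball z r \<inter> \<Omega>) (\<lambda>x. f n x - finf x)) \<longlonglongrightarrow> 0"
    using H unfolding property_H_def by blast
  define S where "S = eball z r \<inter> \<Omega>"
  obtain r' :: real where r': "0 < r'" "ereal r' < r"
    using ereal_dense2[OF r] by (metis ereal_less(2))
  obtain \<rho>' where \<rho>': "0 < \<rho>'" "ball z \<rho>' \<subseteq> \<Omega>"
    using openE[OF \<Omega> z] by metis
  define \<rho> where "\<rho> = min r' \<rho>'"
  have \<rho>: "0 < \<rho>" "ball z \<rho> \<subseteq> \<Omega>" using r' \<rho>' by (auto simp: \<rho>_def)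
  have "ball z \<rho> \<subseteq> eball z r"
    unfolding eball_def \<rho>_def using r'(2) by (auto intro: less_trans[of "ereal (dist z _)" "ereal r'"])
  with \<rho> have S: "ball z \<rho> \<subseteq> S" by (simp add: S_def)
  \<comment> \<open>\<open>enn2real\<close> sends an infinite seminorm to 0; the estimate is
    therefore claimed for large \<open>n\<close>, where the seminorm is finite.\<close>
  define e where "e = (\<lambda>n. enn2real (lip_seminorm S (\<lambda>x. f n x - finf x)))"
  have e: "e \<longlonglongrightarrow> 0"
    unfolding e_def using semi by (intro tendsto_enn2real[where l = 0, simplified]) (auto simp: S_def)
  have finite: "\<forall>\<^sub>F n in sequentially. lip_seminorm S (\<lambda>x. f n x - finf x) < top"
    using semi by (intro order_tendstoD(2)) (auto simp: S_def)
  have uniform: "\<forall>\<^sub>F n in sequentially. \<forall>x\<in>ball z \<rho>. \<forall>y\<in>ball z \<rho>.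
      \<bar>(f n x - finf x) - (f n y - finf y)\<bar> \<le> e n * norm (x - y)"
    using finite
  proof eventually_elim
    case (elim n)
    have eq: "lip_seminorm S (\<lambda>x. f n x - finf x) = ennreal (e n)"
      using elim by (simp add: e_def)
    show ?case
    proof (intro ballI)
      fix x y assume "x \<in> ball z \<rho>" "y \<in> ball z \<rho>"
      then have "ennreal \<bar>(f n x - finf x) - (f n y - finf y)\<bar> \<le> ennreal (e n) * ennreal (norm (x - y))"
        using le_lip_seminorm[of x S y "\<lambda>x. f n x - finf x"] S unfolding eq by blast
      then show "\<bar>(f n x - finf x) - (f n y - finf y)\<bar> \<le> e n * norm (x - y)"
        by (simp add: e_def flip: ennreal_mult)
    qed
  qed
  have "\<forall>\<^sub>F n in sequentially. e n < 1" using e by (rule order_tendstoD) simp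
  with uniform have "\<forall>\<^sub>F n in sequentially. \<forall>x\<in>ball z \<rho>. \<forall>y\<in>ball z \<rho>.
      \<bar>f n x - f n y\<bar> \<le> (L' + 1) * norm (x - y)"
  proof eventually_elim
    case (elim n)
    show ?case
    proof (intro ballI)
      fix x y assume xy: "x \<in> ball z \<rho>" "y \<in> ball z \<rho>"
      have "\<bar>finf x - finf y\<bar> \<le> L' * norm (x - y)"
        using xy S by (intro lipschitz_onD[OF L'[folded S_def], unfolded dist_norm real_norm_def]) auto
      moreover have "\<bar>(f n x - finf x) - (f n y - finf y)\<bar> \<le> e n * norm (x - y)"
        using elim(1) xy by blast
      moreover have "e n * norm (x - y) \<le> norm (x - y)"
        using elim(2) mult_right_mono[of "e n" 1 "norm (x - y)"] by simp
      ultimately show "\<bar>f n x - f n y\<bar> \<le> (L' + 1) * norm (x - y)"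
        by (simp add: algebra_simps)
    qed
  qed
  then obtain N where N: "\<And>n x y. n \<ge> N \<Longrightarrow> x \<in> ball z \<rho> \<Longrightarrow> y \<in> ball z \<rho> \<Longrightarrow>
      \<bar>f n x - f n y\<bar> \<le> (L' + 1) * norm (x - y)"
    unfolding eventually_sequentially by blast
  obtain l where l: "\<And>n. (l n)-lipschitz_on S (f n)"
    using L unfolding S_def by metis
  \<comment> \<open>Dominates \<open>L' + 1\<close>, valid from \<open>N\<close> on, and every
    \<open>l n\<close> with n < N.\<close>
  define C where "C = (\<bar>L'\<bar> + 1) + (\<Sum>n<N. \<bar>l n\<bar>)"
  have C: "\<bar>f n x - f n y\<bar> \<le> C * norm (x - y)" if xy: "x \<in> ball z \<rho>" "y \<in> ball z \<rho>" for n x y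
  proof (cases "n < N")
    case True
    have "\<bar>l n\<bar> \<le> (\<Sum>n<N. \<bar>l n\<bar>)" using True by (intro member_le_sum) auto
    then have "l n \<le> C" by (simp add: C_def)
    moreover have "\<bar>f n x - f n y\<bar> \<le> l n * norm (x - y)"
      using xy S by (intro lipschitz_onD[OF l, unfolded dist_norm real_norm_def]) auto
    ultimately show ?thesis by (meson mult_right_mono norm_ge_zero order_trans)
  next
    case False
    have "0 \<le> (\<Sum>n<N. \<bar>l n\<bar>)" by (simp add: sum_nonneg)
    then have "L' + 1 \<le> C" unfolding C_def by linarith
    moreover have "\<bar>f n x - f n y\<bar> \<le> (L' + 1) * norm (x - y)" using N False xy by simp
    ultimately show ?thesis by (meson mult_right_mono norm_ge_zero order_trans)
  qed
  have "convex_family \<Omega> f finf z \<rho> C e"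
    by unfold_locales (fact \<Omega> f \<rho> C lim e uniform)+
  then show thesis by (rule that)
qed

text \<open>Convexity makes the quotients converge, so the upper limit in property (H) is the
  directional derivative itself.\<close>

lemma property_H_sublinear_dplus:
  assumes "open \<Omega>" "convex_on \<Omega> (f n)" "z \<in> \<Omega>" "property_H \<Omega> f z finf"
  shows "sublinear (dplus (f n) z)"
proof -
  obtain p where p: "sublinear p" "\<And>u. upper_dini (f n) z u = ereal (p u)"
    using assms(4) unfolding property_H_def by metis
  have "upper_dini (f n) z u = ereal (dplus (f n) z u)" for u
    unfolding upper_dini_def
    by (intro lim_imp_Limsup trivial_limit_at_right_real tendsto_ereal
        convex_on_tendsto_dplus[OF assms(2,1,3)])
  with p(2) have "dplus (f n) z = p" by auto
  with p(1) show ?thesis by simp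
qed

section \<open>Optimality conditions\<close>

lemma multipliersD:
  assumes "multipliers f finf z binf b"
  shows "0 \<le> binf" "0 \<le> b n" "binf * finf z = 0" "b (Suc n) * f (Suc n) z = 0"
  using assms by (auto simp: multipliers_def)

section \<open>Multipliers and solutions\<close>

context convex_family
begin

text \<open>In the direction \<open>x - z\<close>, a constraint with nonzero multiplier vanishes at
  \<open>z\<close>, so its derivative is at most \<open>f n x\<close>, hence nonpositive. This
  forces the derivative of \<open>f 0\<close>, which is at most \<open>f 0 x - f 0 z\<close>, to be
  nonnegative.\<close>

lemma derivative_condition_imp_is_solution:
  assumes feas: "feasible \<Omega> f z" and mult: "multipliers f finf z binf b"
    and deriv: "derivative_condition f finf z binf b"
  shows "is_solution \<Omega> f z"
  unfolding is_solution_def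
proof (intro conjI allI impI feas)
  fix x assume x: "feasible \<Omega> f x"
  define u where "u = x - z"
  have le: "dplus (f n) z u \<le> f n x - f n z" for n
    unfolding u_def using x by (intro convex_on_dplus_le_diff[OF f \<Omega> z(1)]) (auto simp: feasible_def)
  have terms: "b (Suc n) * dplus (f (Suc n)) z u \<le> 0" for n
  proof (cases "b (Suc n) = 0")
    case False
    then have "f (Suc n) z = 0" using mult by (auto simp: multipliers_def)
    then have "dplus (f (Suc n)) z u \<le> 0"
      using le[of "Suc n"] spec[OF conjunct2[OF x[unfolded feasible_def]], of "Suc n"] by simp
    then show ?thesis using mult by (simp add: multipliers_def mult_nonneg_nonpos)
  qed simp
  have "(\<Sum>n. b (Suc n) * dplus (f (Suc n)) z u) \<le> 0"
    using suminf_le[OF terms _ summable_zero] deriv by (simp add: derivative_condition_def)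
  \<comment> \<open>\<open>finf\<close> is known to be convex near \<open>z\<close>, whereas
    \<open>x\<close> may be far away; the bound is obtained for the \<open>f n\<close> and passed to
    the limit.\<close>
  moreover have "binf * dplus finf z u \<le> 0"
  proof (cases "binf = 0")
    case False
    then have "finf z = 0" using mult by (auto simp: multipliers_def)
    then have "(\<lambda>n. - f n z) \<longlonglongrightarrow> 0" using tendsto_minus[OF limit] by simp
    moreover have "dplus (f n) z u \<le> - f n z" if "n \<ge> 1" for n
      using le[of n] x that by (force simp: feasible_def)
    ultimately have "dplus finf z u \<le> 0"
      by (intro LIMSEQ_le[OF tendsto_dplus]) auto
    then show ?thesis using mult by (simp add: multipliers_def mult_nonneg_nonpos)
  qed simp
  moreover have "0 \<le> dplus (f 0) z u + binf * dplus finf z u + (\<Sum>n. b (Suc n) * dplus (f (Suc n)) z u)"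
    using deriv by (simp add: derivative_condition_def)
  ultimately show "f 0 z \<le> f 0 x" using le[of 0] by linarith
qed

lemma is_solution_imp_multipliers:
  assumes sol: "is_solution \<Omega> f z"
    and sublinear: "\<And>n. sublinear (dplus (f n) z)"
    and slater: "0 < \<delta>" "\<And>n. n \<ge> 1 \<Longrightarrow> dplus (f n) z w \<le> - \<delta>"
  shows "\<exists>binf b. multipliers f finf z binf b \<and> derivative_condition f finf z binf b"
proof -
  have feas: "feasible \<Omega> f z" using sol by (simp add: is_solution_def)
  \<comment> \<open>The active constraints, shifted by one: n stands for \<open>f (Suc n)\<close>.
    If \<open>finf z\<close> is nonzero, only finitely many constraints can be active, as required
    when mass at infinity is excluded.\<close>
  define J where "J = {n. f (Suc n) z = 0}"
  have J: "finf z = 0 \<or> finite J"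
  proof (cases "finf z = 0")
    case False
    then have "\<forall>\<^sub>F n in sequentially. f (Suc n) z \<noteq> 0"
      using tendsto_imp_eventually_ne[OF LIMSEQ_Suc[OF limit]] by simp
    then obtain N where "\<And>n. n \<ge> N \<Longrightarrow> f (Suc n) z \<noteq> 0"
      unfolding eventually_sequentially by blast
    then have "J \<subseteq> {..<N}" unfolding J_def by (auto simp: not_le[symmetric])
    then show ?thesis using finite_subset by blast
  qed simp
  obtain binf b where b: "0 \<le> binf" "\<And>n. 0 \<le> b n" "\<And>n. n \<notin> J \<Longrightarrow> b n = 0" "finf z \<noteq> 0 \<Longrightarrow> binf = 0"
    "\<And>u. summable (\<lambda>n. b n * dplus (f (Suc n)) z u)"
    "\<And>u. 0 \<le> dplus (f 0) z u + binf * dplus finf z u + (\<Sum>n. b n * dplus (f (Suc n)) z u)"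
  proof (rule sublinear_multipliers)
    show "sublinear (dplus (f 0) z)" "sublinear (dplus (f (Suc n)) z)" for n
      by (rule sublinear)+
    show "(\<lambda>n. dplus (f (Suc n)) z u) \<longlonglongrightarrow> dplus finf z u" for u
      by (rule LIMSEQ_Suc[OF tendsto_dplus])
    show "0 < \<delta>" "dplus (f (Suc n)) z w \<le> - \<delta>" for n using slater by auto
    show "finf z = 0 \<or> finite J" by (rule J)
    show False if "dplus (f 0) z u < 0" "\<And>n. n \<in> J \<Longrightarrow> dplus (f (Suc n)) z u < 0"
      "finf z = 0 \<Longrightarrow> dplus finf z u < 0" for u
    proof -
      have "dplus (f n) z u < 0" if "n \<ge> 1" "f n z = 0" for n
        using that \<open>\<And>n. n \<in> J \<Longrightarrow> dplus (f (Suc n)) z u < 0\<close>[of "n - 1"] by (simp add: J_def)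
      then have "\<exists>x. feasible \<Omega> f x \<and> f 0 x < f 0 z"
        using strict_descent[OF feas] that(1,3) by blast
      then show False using sol by (force simp: is_solution_def)
    qed
  qed blast
  \<comment> \<open>Undoes the index shift; index 0, the objective, receives multiplier 0.\<close>
  define b' where "b' = (\<lambda>n. case n of 0 \<Rightarrow> 0 | Suc m \<Rightarrow> b m)"
  have b'_Suc: "b' (Suc n) = b n" for n by (simp add: b'_def)
  have "b' n * f n z = 0" if "n \<ge> 1" for n
    using that b(3)[of "n - 1"] by (cases n) (auto simp: b'_def J_def)
  moreover have "0 \<le> b' n" for n using b(2) by (simp add: b'_def split: nat.split)
  ultimately have "multipliers f finf z binf b'"
    using b(1,4) by (auto simp: multipliers_def)
  moreover have "derivative_condition f finf z binf b'"
    using b(5,6) by (simp add: derivative_condition_def b'_Suc)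
  ultimately show ?thesis by blast
qed

section \<open>The derivative condition and minima of the Lagrangian\<close>

lemma lagrangian_at_point:
  assumes "multipliers f finf z binf b"
  shows "lagrangian f finf binf b z = ereal (f 0 z)"
  by (simp add: lagrangian_def multipliersD[OF assms] flip: zero_ereal_def)

text \<open>Each term \<open>a n\<close> of the series at \<open>x\<close> is at least the
  derivative term \<open>c n\<close>; the series of \<open>c\<close> converges, so that of
  \<open>a\<close> equals it plus a nonnegative excess. Convexity of \<open>finf\<close> on \<Omega>
  supplies the same inequality for the limit term.\<close>

lemma derivative_condition_imp_minimum_condition:
  assumes finf: "convex_on \<Omega> finf" and mult: "multipliers f finf z binf b"
    and deriv: "derivative_condition f finf z binf b"
  shows "minimum_condition \<Omega> f finf z binf b"
  unfolding minimum_condition_def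
proof
  fix x assume x: "x \<in> \<Omega>"
  define u where "u = x - z"
  define c where "c = (\<lambda>n. b (Suc n) * dplus (f (Suc n)) z u)"
  define a where "a = (\<lambda>n. b (Suc n) * f (Suc n) x)"
  have le: "dplus (f n) z u \<le> f n x - f n z" for n
    unfolding u_def using x by (intro convex_on_dplus_le_diff[OF f \<Omega> z(1)])
  have "c n \<le> a n" for n
  proof -
    have "c n \<le> b (Suc n) * (f (Suc n) x - f (Suc n) z)"
      unfolding c_def using le mult by (intro mult_left_mono) (auto simp: multipliers_def)
    then show ?thesis using multipliersD(4)[OF mult, of n] by (simp add: a_def right_diff_distrib)
  qed
  then have nonneg: "0 \<le> ereal (a n - c n)" for n by simp
  \<comment> \<open>The total excess may be \<infinity>; adding the real number
    \<open>suminf c\<close> is still well defined.\<close>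
  define D where "D = (\<Sum>n. ereal (a n - c n))"
  have "summable (\<lambda>n. ereal (a n - c n))" using nonneg by (rule summable_ereal_pos)
  then have D: "(\<lambda>n. ereal (a n - c n)) sums D" unfolding D_def by (rule summable_sums)
  have "0 \<le> D" unfolding D_def using nonneg by (rule suminf_0_le)
  have c: "summable c" "0 \<le> dplus (f 0) z u + binf * dplus finf z u + suminf c"
    using deriv by (auto simp: derivative_condition_def c_def)
  have "(\<lambda>N. (\<Sum>n<N. ereal (a n - c n)) + (\<Sum>n<N. ereal (c n))) \<longlonglongrightarrow> D + ereal (suminf c)"
    using D sums_ereal[THEN iffD2, OF summable_sums[OF c(1)]] unfolding sums_def
    by (intro tendsto_add_ereal_general) auto
  then have a: "(\<lambda>n. ereal (a n)) sums (D + ereal (suminf c))"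
    unfolding sums_def by (simp add: sum_subtractf)
  have "binf * dplus finf z u \<le> binf * (finf x - finf z)"
    unfolding u_def using mult x
    by (intro mult_left_mono convex_on_dplus_le_diff[OF finf \<Omega> z(1)]) (auto simp: multipliers_def)
  also have "\<dots> = binf * finf x" using mult by (simp add: multipliers_def right_diff_distrib)
  finally have "f 0 z \<le> f 0 x + binf * finf x + suminf c" using c(2) le[of 0] by linarith
  then have "ereal (f 0 z) \<le> ereal (f 0 x + binf * finf x) + ereal (suminf c)" by simp
  also have "\<dots> \<le> ereal (f 0 x + binf * finf x) + (D + ereal (suminf c))"
    using add_right_mono[OF \<open>0 \<le> D\<close>, of "ereal (suminf c)"] by (intro add_left_mono) simp
  also have "\<dots> = lagrangian f finf binf b x"
    using sums_unique[OF a] by (simp add: lagrangian_def a_def)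
  finally have "lagrangian f finf binf b z \<le> lagrangian f finf binf b x"
    by (simp add: lagrangian_at_point[OF mult])
  with a show "summable (\<lambda>n. ereal (b (Suc n) * f (Suc n) x)) \<and>
      lagrangian f finf binf b z \<le> lagrangian f finf binf b x"
    unfolding a_def by (blast intro: sums_summable)
qed

text \<open>In the direction \<open>w\<close> all but finitely many terms of the series are at most a fixed negative
  multiple of \<open>b n\<close>, and the series is bounded below at a minimum.\<close>

lemma minimum_condition_summable:
  assumes mult: "multipliers f finf z binf b" and min: "minimum_condition \<Omega> f finf z binf b"
    and slater: "dplus finf z w < 0"
  shows "summable (\<lambda>n. b (Suc n))"
proof -
  define \<delta> where "\<delta> = - dplus finf z w / 2"
  have \<delta>: "0 < \<delta>" "dplus finf z w < - \<delta>" using slater by (auto simp: \<delta>_def)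
  obtain N where "\<forall>\<^sub>F t in at_right 0. \<forall>n\<ge>N. diff_quotient (f n) z w t < - \<delta>"
    using quotient_uniformly_less[OF \<delta>(2)] .
  then have "\<forall>\<^sub>F t in at_right 0. (\<forall>n\<ge>N. diff_quotient (f n) z w t < - \<delta>) \<and> 0 < t \<and> z + t *\<^sub>R w \<in> ball z \<rho>"
    using eventually_line_in_ball[of w] by (rule eventually_conj)
  then obtain t where t: "\<And>n. n \<ge> N \<Longrightarrow> diff_quotient (f n) z w t < - \<delta>" "0 < t" "z + t *\<^sub>R w \<in> ball z \<rho>"
    using eventually_happens'[OF trivial_limit_at_right_real] by blast
  define x where "x = z + t *\<^sub>R w"
  define a where "a = (\<lambda>n. b (Suc n) * f (Suc n) x)"
  have x: "x \<in> \<Omega>" using t(3) \<rho>(2) by (auto simp: x_def)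
  have a_le: "b (Suc n) * (t * \<delta>) \<le> - a n" if "n \<ge> N" for n
  proof -
    have "f (Suc n) x - f (Suc n) z \<le> - (t * \<delta>)"
      using t(1)[of "Suc n"] t(2) that by (simp add: x_def divide_less_eq algebra_simps)
    then have "b (Suc n) * (f (Suc n) x - f (Suc n) z) \<le> b (Suc n) * (- (t * \<delta>))"
      using mult by (intro mult_left_mono) (auto simp: multipliers_def)
    then show ?thesis using multipliersD(4)[OF mult, of n] by (simp add: a_def right_diff_distrib)
  qed
  have summ: "(\<lambda>n. ereal (a n)) sums (\<Sum>n. ereal (a n))"
    using min x by (intro summable_sums) (simp add: minimum_condition_def a_def)
  have "ereal (f 0 z) \<le> ereal (f 0 x + binf * finf x) + (\<Sum>n. ereal (a n))"
    using min x lagrangian_at_point[OF mult] by (auto simp: minimum_condition_def lagrangian_def a_def)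
  \<comment> \<open>The value -\<infinity> would put the Lagrangian at \<open>x\<close> below its
    real value at \<open>z\<close>.\<close>
  then have "- \<infinity> < (\<Sum>n. ereal (a n))"
    by (cases "\<Sum>n. ereal (a n)") auto
  then obtain r where r: "ereal r < (\<Sum>n. ereal (a n))"
    using ereal_dense2 by blast
  have "\<forall>\<^sub>F k in sequentially. ereal r < (\<Sum>n<k. ereal (a n))"
    using summ r unfolding sums_def by (rule order_tendstoD)
  then obtain K' where K': "\<And>k. k \<ge> K' \<Longrightarrow> r < (\<Sum>n<k. a n)"
    unfolding eventually_sequentially by auto
  \<comment> \<open>From \<open>N\<close> on each term satisfies \<open>a_le\<close>, and from
    \<open>K'\<close> on the partial sums exceed \<open>r\<close>; \<open>K\<close> secures both, so
    the sums of \<open>- a\<close> beyond \<open>K\<close> are bounded.\<close>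
  define K where "K = max N K'"
  have "summable (\<lambda>n. b (Suc (n + K)) * (t * \<delta>))"
  proof (rule summableI_nonneg_bounded)
    show "0 \<le> b (Suc (n + K)) * (t * \<delta>)" for n
      using mult t(2) \<delta>(1) by (simp add: multipliers_def)
    fix m
    have "(\<Sum>n<m. b (Suc (n + K)) * (t * \<delta>)) \<le> (\<Sum>n<m. - a (n + K))"
      by (intro sum_mono a_le) (simp add: K_def)
    also have "\<dots> = (\<Sum>n<K. a n) - (\<Sum>n<K + m. a n)"
      by (induction m) (simp_all add: add.commute)
    also have "\<dots> \<le> (\<Sum>n<K. a n) - r" using K'[of "K + m"] by (simp add: K_def less_imp_le)
    finally show "(\<Sum>n<m. b (Suc (n + K)) * (t * \<delta>)) \<le> (\<Sum>n<K. a n) - r" .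
  qed
  then have "summable (\<lambda>n. b (Suc (n + K)) * (t * \<delta>) / (t * \<delta>))" by (rule summable_divide)
  then have "summable (\<lambda>n. b (Suc (n + K)))" using t(2) \<delta>(1) by simp
  then show ?thesis by (rule summable_iff_shift[THEN iffD1])
qed

text \<open>Increments of the Lagrangian divided by \<open>t\<close> are nonnegative, and their
  limit is the derivative condition. Tannery's theorem interchanges limit and series, since the
  quotients are bounded by \<open>C * norm u\<close> and \<open>b\<close> is summable.\<close>

lemma minimum_condition_imp_derivative_condition:
  assumes mult: "multipliers f finf z binf b" and min: "minimum_condition \<Omega> f finf z binf b"
    and slater: "dplus finf z w < 0"
  shows "derivative_condition f finf z binf b"
  unfolding derivative_condition_def
proof
  fix u
  note b = minimum_condition_summable[OF assms]
  define a where "a = (\<lambda>n t. b (Suc n) * diff_quotient (f (Suc n)) z u t)"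
  define M where "M = (\<lambda>n. b (Suc n) * (C * norm u))"
  have M: "summable M" unfolding M_def using b by (rule summable_mult2)
  have a_bound: "norm (a n t) \<le> M n" if t: "0 < t" "z + t *\<^sub>R u \<in> ball z \<rho>" for n t
  proof -
    have "norm (a n t) = b (Suc n) * \<bar>diff_quotient (f (Suc n)) z u t\<bar>"
      unfolding a_def real_norm_def abs_mult by (simp only: abs_of_nonneg[OF multipliersD(2)[OF mult]])
    also have "\<dots> \<le> M n"
      unfolding M_def by (rule mult_left_mono[OF quotient_bounded[OF t] multipliersD(2)[OF mult]])
    finally show ?thesis .
  qed
  have tannery: "summable (\<lambda>n. norm (b (Suc n) * dplus (f (Suc n)) z u)) \<and>
      ((\<lambda>t. \<Sum>n. a n t) \<longlongrightarrow> (\<Sum>n. b (Suc n) * dplus (f (Suc n)) z u)) (at_right 0)"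
  proof (rule tannerys_theorem[THEN conjunct2])
    show "((\<lambda>t. a n t) \<longlongrightarrow> b (Suc n) * dplus (f (Suc n)) z u) (at_right 0)" for n
      unfolding a_def by (intro tendsto_intros tendsto_quotient)
    show "\<forall>\<^sub>F (n, t) in sequentially \<times>\<^sub>F at_right 0. norm (a n t) \<le> M n"
      unfolding eventually_prod_filter
      by (rule exI[of _ "\<lambda>_. True"], rule exI[of _ "\<lambda>t. 0 < t \<and> z + t *\<^sub>R u \<in> ball z \<rho>"])
        (use eventually_line_in_ball[of u] a_bound in auto)
    show "summable M" by (rule M)
  qed simp
  have nonneg: "\<forall>\<^sub>F t in at_right 0. 0 \<le> diff_quotient (f 0) z u t + binf * diff_quotient finf z u t + (\<Sum>n. a n t)"
    using eventually_line_in_ball[of u]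
  proof eventually_elim
    case (elim t)
    define x where "x = z + t *\<^sub>R u"
    have x: "x \<in> \<Omega>" using elim \<rho>(2) by (auto simp: x_def)
    \<comment> \<open>On the ball the domination makes the series converge, so its extended real sum
      is a real number.\<close>
    have summ: "summable (\<lambda>n. a n t)"
      using elim by (intro summable_comparison_test'[OF M, of 0] a_bound) auto
    have a_eq: "b (Suc n) * f (Suc n) x = t * a n t" for n
    proof -
      have "t * a n t = b (Suc n) * (f (Suc n) x - f (Suc n) z)"
        using elim by (simp add: a_def x_def)
      then show ?thesis using multipliersD(4)[OF mult, of n] by (simp only: right_diff_distrib diff_0_right)
    qed
    have "(\<lambda>n. t * a n t) sums (t * (\<Sum>n. a n t))"
      by (rule sums_mult[OF summable_sums[OF summ]])
    then have "(\<lambda>n. ereal (b (Suc n) * f (Suc n) x)) sums ereal (t * (\<Sum>n. a n t))"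
      unfolding a_eq by (rule sums_ereal[THEN iffD2])
    from sums_unique[OF this, symmetric] have "lagrangian f finf binf b x = ereal (f 0 x + binf * finf x) + ereal (t * (\<Sum>n. a n t))"
      unfolding lagrangian_def by (rule arg_cong)
    moreover have "ereal (f 0 z) \<le> lagrangian f finf binf b x"
      using min x lagrangian_at_point[OF mult] by (auto simp: minimum_condition_def)
    ultimately have "0 \<le> (f 0 x - f 0 z) + binf * finf x + t * (\<Sum>n. a n t)" by simp
    also have "binf * finf x = binf * (finf x - finf z)"
      using mult by (simp add: multipliers_def right_diff_distrib)
    finally have "0 \<le> ((f 0 x - f 0 z) + binf * (finf x - finf z) + t * (\<Sum>n. a n t)) / t"
      using elim by (intro divide_nonneg_pos) auto
    then show ?case using elim by (simp add: x_def add_divide_distrib)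
  qed
  have lim: "((\<lambda>t. diff_quotient (f 0) z u t + binf * diff_quotient finf z u t + (\<Sum>n. a n t)) \<longlongrightarrow>
      dplus (f 0) z u + binf * dplus finf z u + (\<Sum>n. b (Suc n) * dplus (f (Suc n)) z u)) (at_right 0)"
    using tannery by (intro tendsto_intros tendsto_quotient tendsto_quotient_finf) auto
  have "0 \<le> dplus (f 0) z u + binf * dplus finf z u + (\<Sum>n. b (Suc n) * dplus (f (Suc n)) z u)"
    by (rule tendsto_lowerbound[OF lim nonneg trivial_limit_at_right_real])
  moreover have "summable (\<lambda>n. b (Suc n) * dplus (f (Suc n)) z u)"
    by (rule summable_norm_cancel[OF conjunct1[OF tannery]])
  ultimately show "summable (\<lambda>n. b (Suc n) * dplus (f (Suc n)) z u) \<and>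
      0 \<le> dplus (f 0) z u + binf * dplus finf z u + (\<Sum>n. b (Suc n) * dplus (f (Suc n)) z u)"
    by (intro conjI)
qed

end

text \<open>Feasibility qualifies the equivalence of \<open>A\<close> and \<open>B\<close> because
  the conditions in \<open>B\<close> do not force it; convexity of \<open>finf\<close> on \<Omega>
  qualifies that of \<open>B\<close> and \<open>C\<close> because property (H) may constrain
  \<open>finf\<close> only near \<open>z\<close>.\<close>

theorem corollary4:
  fixes \<Omega> :: "'a::real_normed_vector set"
    and f :: "nat \<Rightarrow> 'a \<Rightarrow> real"
    and finf :: "'a \<Rightarrow> real"
    and z w :: 'a
  assumes "\<Omega> \<noteq> {}" and "convex \<Omega>" and "open \<Omega>"
    and "\<And>n. convex_on \<Omega> (f n)"
    and "\<And>n. \<exists>L. L-lipschitz_on \<Omega> (f n)"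
    and "z \<in> \<Omega>"
    and "property_H \<Omega> f z finf"
    and "(SUP n\<in>{1..}. ereal (dplus (f n) z w)) < 0"
  defines "A \<equiv> is_solution \<Omega> f z"
    and "B \<equiv> \<exists>binf b. multipliers f finf z binf b \<and> derivative_condition f finf z binf b"
    and "C \<equiv> \<exists>binf b. multipliers f finf z binf b \<and> minimum_condition \<Omega> f finf z binf b"
  shows "(feasible \<Omega> f z \<longrightarrow> (A \<longleftrightarrow> B)) \<and>
         (convex_on \<Omega> finf \<longrightarrow> (B \<longleftrightarrow> C)) \<and>
         (C \<longrightarrow> B)"
proof -
  obtain \<rho> L e where "convex_family \<Omega> f finf z \<rho> L e"
    using property_H_convex_family[OF assms(3,4,6,7)] .
  then interpret convex_family \<Omega> f finf z \<rho> L e .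
  \<comment> \<open>A real number strictly between the extended real supremum and 0;
    \<open>- r\<close> serves as the constant \<delta> of the Slater condition.\<close>
  obtain r where r: "(SUP n\<in>{1..}. ereal (dplus (f n) z w)) < ereal r" "ereal r < 0"
    using ereal_dense2[OF assms(8)] by blast
  have slater: "dplus (f n) z w \<le> - (- r)" if "n \<ge> 1" for n
  proof -
    have "ereal (dplus (f n) z w) \<le> (SUP n\<in>{1..}. ereal (dplus (f n) z w))"
      using that by (intro SUP_upper) auto
    with r(1) have "ereal (dplus (f n) z w) < ereal r" by (rule le_less_trans[rotated])
    then show ?thesis by simp
  qed
  have slater_inf: "dplus finf z w < 0"
  proof -
    have "dplus finf z w \<le> r"
      by (rule LIMSEQ_le_const2[OF tendsto_dplus]) (use slater in auto)
    with r(2) show ?thesis by simp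
  qed
  have "C \<Longrightarrow> B"
    unfolding B_def C_def using minimum_condition_imp_derivative_condition[OF _ _ slater_inf] by blast
  moreover have "convex_on \<Omega> finf \<Longrightarrow> B \<Longrightarrow> C"
    unfolding B_def C_def using derivative_condition_imp_minimum_condition by blast
  moreover have "feasible \<Omega> f z \<Longrightarrow> B \<Longrightarrow> A"
    unfolding A_def B_def using derivative_condition_imp_is_solution by blast
  moreover have "B" if A
    unfolding B_def
  proof (rule is_solution_imp_multipliers)
    show "is_solution \<Omega> f z" using that by (simp add: A_def)
    show "sublinear (dplus (f n) z)" for n by (rule property_H_sublinear_dplus[OF assms(3,4,6,7)])
    show "0 < - r" using r(2) by simp
    show "dplus (f n) z w \<le> - (- r)" if "n \<ge> 1" for n using that by (rule slater)
  qed
  ultimately show ?thesis by blast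
qed

end
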